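(* Let $n\ge2$, let $f\in\mathbb{Z}[X]$ be monic of degree $n$, and let $\mathcal{V}_f\subseteq\mathbb{C}^{n\times n}$ be the algebraic set of $n\times n$ matrices with complex entries and characteristic polynomial $f$. Then $\mathcal{V}_f$ is an absolutely irreducible non-linear variety of dimension $\dim\mathcal{V}_f=n^2-n$.
   Context: The characteristic polynomial of $A$ is $\det(XI_n-A)$. "Non-linear" means that $\mathcal{V}_f$ is not an affine linear subspace of $\mathbb{C}^{n\times n}$. *)

theory Defs
  imports "Jordan_Normal_Form.Char_Poly" "HOL-Library.Extended_Nat"
begin

text \<open>Affine space is the space \<^term>\<open>carrier_mat n n :: complex mat set\<close> of complex
  matrices, with the \<open>n * n\<close> matrix entries as coordinates.  Polynomials in these coordinates
  are represented by the functions they define; over an infinite field this loses nothing.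
  Their values outside \<^term>\<open>carrier_mat n n\<close> are irrelevant.\<close>

inductive_set polynomial_functions :: "nat \<Rightarrow> (complex mat \<Rightarrow> complex) set" for n :: nat where
  const: "(\<lambda>A. c) \<in> polynomial_functions n"
| entry: "i < n \<Longrightarrow> j < n \<Longrightarrow> (\<lambda>A. A $$ (i, j)) \<in> polynomial_functions n"
| add: "p \<in> polynomial_functions n \<Longrightarrow> q \<in> polynomial_functions n
    \<Longrightarrow> (\<lambda>A. p A + q A) \<in> polynomial_functions n"
| mult: "p \<in> polynomial_functions n \<Longrightarrow> q \<in> polynomial_functions n
    \<Longrightarrow> (\<lambda>A. p A * q A) \<in> polynomial_functions n"

definition algebraic_set :: "nat \<Rightarrow> complex mat set \<Rightarrow> bool" where
  "algebraic_set n Z \<longleftrightarrow>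
     (\<exists>P \<subseteq> polynomial_functions n. Z = {A \<in> carrier_mat n n. \<forall>p\<in>P. p A = 0})"

text \<open>The ground field is algebraically closed, so irreducibility with respect to algebraic
  sets defined over \<open>\<complex>\<close> is absolute irreducibility.\<close>

definition absolutely_irreducible_variety :: "nat \<Rightarrow> complex mat set \<Rightarrow> bool" where
  "absolutely_irreducible_variety n Z \<longleftrightarrow>
     algebraic_set n Z \<and> Z \<noteq> {} \<and>
     (\<forall>Z1 Z2. algebraic_set n Z1 \<and> algebraic_set n Z2 \<and> Z = Z1 \<union> Z2 \<longrightarrow> Z = Z1 \<or> Z = Z2)"

text \<open>Krull dimension in the Zariski topology: the supremum of the lengths \<open>k\<close> of strict chains
  \<open>C 0 \<subset> \<dots> \<subset> C k\<close> of irreducible closed subsets of \<open>Z\<close>.  With values in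
  \<^typ>\<open>enat\<close> the empty set gets dimension \<open>0\<close>.\<close>

definition variety_dim :: "nat \<Rightarrow> complex mat set \<Rightarrow> enat" where
  "variety_dim n Z = Sup {enat k | k. \<exists>C :: nat \<Rightarrow> complex mat set.
     (\<forall>i\<le>k. absolutely_irreducible_variety n (C i) \<and> C i \<subseteq> Z) \<and> (\<forall>i<k. C i \<subset> C (Suc i))}"

definition linear_subspace :: "nat \<Rightarrow> complex mat set \<Rightarrow> bool" where
  "linear_subspace n W \<longleftrightarrow>
     W \<subseteq> carrier_mat n n \<and> 0\<^sub>m n n \<in> W \<and>
     (\<forall>A\<in>W. \<forall>B\<in>W. A + B \<in> W) \<and> (\<forall>c. \<forall>A\<in>W. c \<cdot>\<^sub>m A \<in> W)"

definition affine_linear_subspace :: "nat \<Rightarrow> complex mat set \<Rightarrow> bool" where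
  "affine_linear_subspace n Z \<longleftrightarrow>
     (\<exists>A\<in>carrier_mat n n. \<exists>W. linear_subspace n W \<and> Z = (\<lambda>B. A + B) ` W)"

definition char_poly_variety :: "nat \<Rightarrow> int poly \<Rightarrow> complex mat set" where
  "char_poly_variety n f = {A \<in> carrier_mat n n. char_poly A = map_poly of_int f}"

end

theory Submission
  imports Defs "HOL-Library.FuncSet" "Jordan_Normal_Form.Schur_Decomposition"
begin

text \<open>Let \<open>V\<close> be the variety of \<open>f\<close> and fix an ordering of the roots of \<open>f\<close>. By Schur, \<open>V\<close> consists of the matrices \<open>G T G\<^sup>-\<^sup>1\<close> with \<open>G\<close>
  invertible and \<open>T\<close> upper triangular with these roots on the diagonal. Both \<open>G\<close> and \<open>T\<close> range over
  affine spaces, so two points of \<open>V\<close> lie on a rational curve inside \<open>V\<close>, and a product of two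
  polynomial functions vanishes on \<open>V\<close> only if one factor does: \<open>V\<close> is irreducible.

  For the lower bound on the dimension, let first \<open>T\<close> (with \<open>G = 1\<close>) gain one coordinate above the diagonal
  at a time, then let \<open>G\<close> gain one coordinate below the diagonal at a time; consecutive steps are separated by a
  coordinate, respectively by a minor of \<open>A - \<lambda>\<^sub>k\<close>.

  For the upper bound, on \<open>V\<close> the \<open>n\<close>-th power of a diagonal entry is a combination of monomials of
  degree at most \<open>n\<close> with fewer diagonal factors. So the functions of degree at most \<open>d\<close> on \<open>V\<close> span
  a space of dimension \<open>O(d\<^sup>N)\<close> with \<open>N = n\<^sup>2 - n\<close>, whereas a chain of \<open>k + 1\<close> irreducible
  subvarieties gives \<open>k\<close> functions whose monomials are linearly independent, hence \<open>k \<le> N\<close>.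

  The variety is not affine because it contains \<open>D\<close>, \<open>D + c E\<^sub>0\<^sub>1\<close> and \<open>D + c E\<^sub>1\<^sub>0\<close> for the diagonal
  matrix \<open>D\<close> of the roots, but not all \<open>D + c (E\<^sub>0\<^sub>1 + E\<^sub>1\<^sub>0)\<close>, which have arbitrary eigenvalues.\<close>

section \<open>Polynomial functions and Zariski closures\<close>

lemma polynomial_functions_uminus:
  assumes "p \<in> polynomial_functions n"
  shows "(\<lambda>A. - p A) \<in> polynomial_functions n"
  using polynomial_functions.mult[OF polynomial_functions.const[of "-1"] assms] by simp

lemma polynomial_functions_diff:
  assumes "p \<in> polynomial_functions n" "q \<in> polynomial_functions n"
  shows "(\<lambda>A. p A - q A) \<in> polynomial_functions n"
  using polynomial_functions.add[OF assms(1) polynomial_functions_uminus[OF assms(2)]] by simp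

lemma polynomial_functions_sum:
  assumes "\<And>i. i \<in> I \<Longrightarrow> p i \<in> polynomial_functions n"
  shows "(\<lambda>A. \<Sum>i\<in>I. p i A) \<in> polynomial_functions n"
  using assms
  by (induction I rule: infinite_finite_induct) (auto intro: polynomial_functions.intros)

lemma polynomial_functions_prod:
  assumes "\<And>i. i \<in> I \<Longrightarrow> p i \<in> polynomial_functions n"
  shows "(\<lambda>A. \<Prod>i\<in>I. p i A) \<in> polynomial_functions n"
  using assms
  by (induction I rule: infinite_finite_induct) (auto intro: polynomial_functions.intros)

lemma polynomial_functions_power:
  assumes "p \<in> polynomial_functions n"
  shows "(\<lambda>A. p A ^ k) \<in> polynomial_functions n"
  using assms by (induction k) (auto intro: polynomial_functions.intros)

text \<open>By the Leibniz formula. It serves both for the equations of the variety and for the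
  minors that separate consecutive strata.\<close>

lemma polynomial_functions_det:
  assumes "\<And>i j. i < m \<Longrightarrow> j < m \<Longrightarrow> (\<lambda>A. M A i j) \<in> polynomial_functions n"
  shows "(\<lambda>A. det (mat m m (\<lambda>(i, j). M A i j))) \<in> polynomial_functions n"
proof -
  have "det (mat m m (\<lambda>(i, j). M A i j)) =
      (\<Sum>p\<in>{p. p permutes {0..<m}}. signof p * (\<Prod>i\<in>{0..<m}. M A i (p i)))" for A
    by (subst det_def'[of _ m]) (auto intro!: sum.cong prod.cong simp: permutes_in_image)
  moreover have "(\<lambda>A. \<Sum>p\<in>{p. p permutes {0..<m}}. signof p * (\<Prod>i\<in>{0..<m}. M A i (p i)))
      \<in> polynomial_functions n"
    by (intro polynomial_functions_sum polynomial_functions.mult polynomial_functions.const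
        polynomial_functions_prod assms) (auto simp: permutes_in_image)
  ultimately show ?thesis by simp
qed

definition zclosure :: "nat \<Rightarrow> complex mat set \<Rightarrow> complex mat set" where
  "zclosure n S = {A \<in> carrier_mat n n. \<forall>p\<in>polynomial_functions n. (\<forall>B\<in>S. p B = 0) \<longrightarrow> p A = 0}"

text \<open>The vanishing ideal of \<open>S\<close> is prime. \<open>S\<close> need not be closed,
  so the property can be tested on a parametrized family in place of its closure.\<close>

definition prime_set :: "nat \<Rightarrow> complex mat set \<Rightarrow> bool" where
  "prime_set n S \<longleftrightarrow> S \<noteq> {} \<and> S \<subseteq> carrier_mat n n \<and>
     (\<forall>p\<in>polynomial_functions n. \<forall>q\<in>polynomial_functions n.
        (\<forall>A\<in>S. p A * q A = 0) \<longrightarrow> (\<forall>A\<in>S. p A = 0) \<or> (\<forall>A\<in>S. q A = 0))"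

lemma prime_setD:
  assumes "prime_set n S" "p \<in> polynomial_functions n" "q \<in> polynomial_functions n"
    and "\<And>A. A \<in> S \<Longrightarrow> p A * q A = 0"
  shows "(\<forall>A\<in>S. p A = 0) \<or> (\<forall>A\<in>S. q A = 0)"
  using assms unfolding prime_set_def by auto

lemma zclosure_mono: "S \<subseteq> S' \<Longrightarrow> zclosure n S \<subseteq> zclosure n S'"
  unfolding zclosure_def by blast

lemma zclosure_superset: "S \<subseteq> carrier_mat n n \<Longrightarrow> S \<subseteq> zclosure n S"
  unfolding zclosure_def by blast

lemma algebraic_set_zclosure: "algebraic_set n (zclosure n S)"
  unfolding algebraic_set_def zclosure_def
  by (rule exI[of _ "{p \<in> polynomial_functions n. \<forall>B\<in>S. p B = 0}"]) auto

lemma zclosure_algebraic_set: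
  assumes "algebraic_set n Z"
  shows "zclosure n Z = Z"
proof -
  from assms obtain P where P: "P \<subseteq> polynomial_functions n"
      and Z: "Z = {A \<in> carrier_mat n n. \<forall>p\<in>P. p A = 0}"
    unfolding algebraic_set_def by blast
  have "zclosure n Z \<subseteq> Z"
    unfolding zclosure_def using P by (subst (2) Z) (auto simp: Z)
  moreover have "Z \<subseteq> zclosure n Z"
    by (rule zclosure_superset) (auto simp: Z)
  ultimately show ?thesis by blast
qed

text \<open>Two proper closed pieces would each miss a point of the closure. A defining equation
  that fails there does not vanish on all of \<open>S\<close>, yet the product of the two equations
  does.\<close>

lemma prime_set_zclosure_irreducible:
  assumes "prime_set n S"
  shows "absolutely_irreducible_variety n (zclosure n S)"
proof -
  have S: "S \<subseteq> zclosure n S" "S \<noteq> {}"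
    using assms zclosure_superset unfolding prime_set_def by auto
  have "zclosure n S = Z1 \<or> zclosure n S = Z2"
    if alg: "algebraic_set n Z1" "algebraic_set n Z2" and eq: "zclosure n S = Z1 \<union> Z2" for Z1 Z2
  proof (rule ccontr)
    assume neg: "\<not> ?thesis"
    from alg obtain P1 P2 where
      P1: "P1 \<subseteq> polynomial_functions n" "Z1 = {A \<in> carrier_mat n n. \<forall>p\<in>P1. p A = 0}" and
      P2: "P2 \<subseteq> polynomial_functions n" "Z2 = {A \<in> carrier_mat n n. \<forall>p\<in>P2. p A = 0}"
      unfolding algebraic_set_def by blast
    from neg eq obtain A1 A2 where A: "A1 \<in> zclosure n S" "A1 \<notin> Z1" "A2 \<in> zclosure n S" "A2 \<notin> Z2"
      by blast
    then obtain p q where p: "p \<in> P1" "p A1 \<noteq> 0" and q: "q \<in> P2" "q A2 \<noteq> 0"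
      unfolding P1(2) P2(2) by (auto simp: zclosure_def)
    have "p B * q B = 0" if "B \<in> S" for B
      using that S eq p(1) q(1) unfolding P1(2) P2(2) by auto
    then have "(\<forall>B\<in>S. p B = 0) \<or> (\<forall>B\<in>S. q B = 0)"
      using assms p q P1 P2 unfolding prime_set_def by blast
    then show False
      using A p q P1(1) P2(1) unfolding zclosure_def by blast
  qed
  moreover have "zclosure n S \<noteq> {}"
    using S by blast
  ultimately show ?thesis
    unfolding absolutely_irreducible_variety_def by (simp add: algebraic_set_zclosure)
qed

lemma algebraic_set_Int_zero:
  assumes "algebraic_set n Z" "p \<in> polynomial_functions n"
  shows "algebraic_set n {A \<in> Z. p A = 0}"
proof -
  from assms obtain P where P: "P \<subseteq> polynomial_functions n"
      and Z: "Z = {A \<in> carrier_mat n n. \<forall>p\<in>P. p A = 0}"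
    unfolding algebraic_set_def by blast
  show ?thesis
    unfolding algebraic_set_def by (rule exI[of _ "insert p P"]) (use P assms Z in auto)
qed

text \<open>If \<open>p * q\<close> vanishes on \<open>Z\<close>, then \<open>Z\<close> is the union
  of the zero loci of \<open>p\<close> and of \<open>q\<close>, both closed.\<close>

lemma irreducible_imp_prime_set:
  assumes "absolutely_irreducible_variety n Z"
  shows "prime_set n Z"
  unfolding prime_set_def
proof (intro conjI ballI impI)
  show "Z \<noteq> {}" "Z \<subseteq> carrier_mat n n"
    using assms unfolding absolutely_irreducible_variety_def algebraic_set_def by auto
  fix p q assume pq: "p \<in> polynomial_functions n" "q \<in> polynomial_functions n"
    and 0: "\<forall>A\<in>Z. p A * q A = 0"
  have "Z = {A \<in> Z. p A = 0} \<union> {A \<in> Z. q A = 0}"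
    using 0 by auto
  then have "Z = {A \<in> Z. p A = 0} \<or> Z = {A \<in> Z. q A = 0}"
    using assms pq algebraic_set_Int_zero unfolding absolutely_irreducible_variety_def by blast
  then show "(\<forall>A\<in>Z. p A = 0) \<or> (\<forall>A\<in>Z. q A = 0)" by blast
qed

section \<open>Conjugates of an affine family of matrices\<close>

definition line_closed :: "nat \<Rightarrow> complex mat set \<Rightarrow> bool" where
  "line_closed n S \<longleftrightarrow> S \<subseteq> carrier_mat n n \<and>
     (\<forall>A\<in>S. \<forall>B\<in>S. \<forall>t. (1 - t) \<cdot>\<^sub>m A + t \<cdot>\<^sub>m B \<in> S)"

text \<open>The equation \<open>A * G = G * T\<close> stands for conjugation by \<open>G\<close>
  without mentioning an inverse matrix.\<close>

definition conj_set :: "nat \<Rightarrow> complex mat set \<Rightarrow> complex mat set \<Rightarrow> complex mat set" where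
  "conj_set n Gs Ts = {A \<in> carrier_mat n n. \<exists>G\<in>Gs. \<exists>T\<in>Ts. det G \<noteq> 0 \<and> A * G = G * T}"

lemma conj_set_mono: "Gs \<subseteq> Gs' \<Longrightarrow> Ts \<subseteq> Ts' \<Longrightarrow> conj_set n Gs Ts \<subseteq> conj_set n Gs' Ts'"
  unfolding conj_set_def by blast

text \<open>The entries along the curve are fractions with common denominator \<open>D\<close>, so a
  power of \<open>D\<close> clears the denominators of any polynomial in them.\<close>

lemma polynomial_functions_on_rational_curve:
  assumes "p \<in> polynomial_functions n"
    and "\<And>t i j. poly D t \<noteq> 0 \<Longrightarrow> i < n \<Longrightarrow> j < n \<Longrightarrow> A t $$ (i, j) * poly D t = poly (E i j) t"
  shows "\<exists>N P. \<forall>t. poly D t \<noteq> 0 \<longrightarrow> p (A t) * poly D t ^ N = poly P t"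
  using assms(1)
proof induction
  case (const c)
  show ?case by (rule exI[of _ 0], rule exI[of _ "[:c:]"]) simp
next
  case (entry i j)
  show ?case by (rule exI[of _ 1], rule exI[of _ "E i j"]) (use entry assms(2) in auto)
next
  case (add p q)
  then obtain N P M Q where "\<forall>t. poly D t \<noteq> 0 \<longrightarrow> p (A t) * poly D t ^ N = poly P t"
    "\<forall>t. poly D t \<noteq> 0 \<longrightarrow> q (A t) * poly D t ^ M = poly Q t" by blast
  moreover have "(p (A t) + q (A t)) * poly D t ^ (N + M) =
      (p (A t) * poly D t ^ N) * poly D t ^ M + (q (A t) * poly D t ^ M) * poly D t ^ N" for t
    by (simp add: power_add ring_distribs mult_ac)
  ultimately have "\<forall>t. poly D t \<noteq> 0 \<longrightarrow>
      (p (A t) + q (A t)) * poly D t ^ (N + M) = poly (P * D ^ M + Q * D ^ N) t"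
    by (simp only: poly_mult poly_add poly_power) simp
  then show ?case by blast
next
  case (mult p q)
  then obtain N P M Q where "\<forall>t. poly D t \<noteq> 0 \<longrightarrow> p (A t) * poly D t ^ N = poly P t"
    "\<forall>t. poly D t \<noteq> 0 \<longrightarrow> q (A t) * poly D t ^ M = poly Q t" by blast
  moreover have "(p (A t) * q (A t)) * poly D t ^ (N + M) =
      (p (A t) * poly D t ^ N) * (q (A t) * poly D t ^ M)" for t
    by (simp add: power_add mult_ac)
  ultimately have "\<forall>t. poly D t \<noteq> 0 \<longrightarrow> p (A t) * q (A t) * poly D t ^ (N + M) = poly (P * Q) t"
    by (simp only: poly_mult) simp
  then show ?case by blast
qed

text \<open>Multiply by \<open>H\<close> on the right. With \<open>H\<close> the adjugate and
  \<open>d\<close> the determinant of \<open>G\<close>, this solves for \<open>A\<close> without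
  division.\<close>

lemma mat_cancel_right:
  assumes "(G :: complex mat) \<in> carrier_mat n n" "H \<in> carrier_mat n n" "G * H = d \<cdot>\<^sub>m 1\<^sub>m n"
    and "A \<in> carrier_mat n n" "B \<in> carrier_mat n n" "A * G = B"
  shows "d \<cdot>\<^sub>m A = B * H"
proof -
  have "B * H = A * (G * H)"
    using assms by (auto simp: assoc_mult_mat)
  also have "\<dots> = d \<cdot>\<^sub>m A"
    using assms by (simp add: mult_smult_distrib[of A n n "1\<^sub>m n" n])
  finally show ?thesis ..
qed

lemma poly_eval_mat_mult:
  assumes "(P :: complex poly mat) \<in> carrier_mat n n" "Q \<in> carrier_mat n n"
  shows "map_mat (\<lambda>p. poly p t) (P * Q) = map_mat (\<lambda>p. poly p t) P * map_mat (\<lambda>p. poly p t) Q"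
  using assms by (intro eq_matI) (auto simp: scalar_prod_def poly_sum)

text \<open>Suppose \<open>p\<close> is nonzero at \<open>A0\<close> and \<open>q\<close> at
  \<open>A1\<close>. Moving \<open>G\<close> and \<open>T\<close> along straight lines joins the two
  points by a rational curve in the family, and on it \<open>p\<close> and \<open>q\<close> become
  nonzero one-variable polynomials after clearing denominators. At a parameter where neither
  vanishes, and \<open>G\<close> is invertible, the product \<open>p * q\<close> is nonzero.\<close>

lemma prime_set_conj_set:
  assumes Gs: "line_closed n Gs" and Ts: "line_closed n Ts" and ne: "conj_set n Gs Ts \<noteq> {}"
  shows "prime_set n (conj_set n Gs Ts)"
  unfolding prime_set_def
proof (intro conjI ballI impI ne)
  show "conj_set n Gs Ts \<subseteq> carrier_mat n n"
    unfolding conj_set_def by blast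
  fix p q assume p: "p \<in> polynomial_functions n" and q: "q \<in> polynomial_functions n"
    and pq: "\<forall>A\<in>conj_set n Gs Ts. p A * q A = 0"
  show "(\<forall>A\<in>conj_set n Gs Ts. p A = 0) \<or> (\<forall>A\<in>conj_set n Gs Ts. q A = 0)"
  proof (rule ccontr)
    assume "\<not> ?thesis"
    then obtain A0 A1 where A0: "A0 \<in> conj_set n Gs Ts" "p A0 \<noteq> 0"
      and A1: "A1 \<in> conj_set n Gs Ts" "q A1 \<noteq> 0" by blast
    from A0 obtain G0 T0 where 0: "G0 \<in> Gs" "T0 \<in> Ts" "det G0 \<noteq> 0" "A0 * G0 = G0 * T0"
      "A0 \<in> carrier_mat n n" unfolding conj_set_def by blast
    from A1 obtain G1 T1 where 1: "G1 \<in> Gs" "T1 \<in> Ts" "det G1 \<noteq> 0" "A1 * G1 = G1 * T1"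
      "A1 \<in> carrier_mat n n" unfolding conj_set_def by blast
    have car: "G0 \<in> carrier_mat n n" "G1 \<in> carrier_mat n n" "T0 \<in> carrier_mat n n" "T1 \<in> carrier_mat n n"
      using 0 1 Gs Ts unfolding line_closed_def by auto
    \<comment> \<open>The segment is a matrix of linear polynomials in the parameter, so its
      determinant and adjugate are polynomial as well.\<close>
    define line :: "complex mat \<Rightarrow> complex mat \<Rightarrow> complex poly mat" where
      "line = (\<lambda>X Y. mat n n (\<lambda>ij. [:X $$ ij, Y $$ ij - X $$ ij:]))"
    define ev :: "complex \<Rightarrow> complex poly mat \<Rightarrow> complex mat" where
      "ev = (\<lambda>t. map_mat (\<lambda>p. poly p t))"
    have line_car: "line X Y \<in> carrier_mat n n" for X Y by (simp add: line_def)
    have ev_line: "ev t (line X Y) = (1 - t) \<cdot>\<^sub>m X + t \<cdot>\<^sub>m Y"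
      if "X \<in> carrier_mat n n" "Y \<in> carrier_mat n n" for X Y t
      using that by (intro eq_matI) (auto simp: ev_def line_def algebra_simps)
    have ev_car: "ev t X \<in> carrier_mat n n" if "X \<in> carrier_mat n n" for X t
      using that by (simp add: ev_def)
    define G where "G = line G0 G1"
    define T where "T = line T0 T1"
    define D where "D = det G"
    define H where "H = adj_mat G"
    have GTH: "G \<in> carrier_mat n n" "T \<in> carrier_mat n n" "H \<in> carrier_mat n n"
      "G * H = D \<cdot>\<^sub>m 1\<^sub>m n" "H * G = D \<cdot>\<^sub>m 1\<^sub>m n"
      unfolding G_def T_def H_def D_def using adj_mat[OF line_car] line_car by auto
    have GH: "ev t G * ev t H = poly D t \<cdot>\<^sub>m 1\<^sub>m n" "ev t H * ev t G = poly D t \<cdot>\<^sub>m 1\<^sub>m n" for t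
    proof -
      have "ev t (D \<cdot>\<^sub>m 1\<^sub>m n) = poly D t \<cdot>\<^sub>m 1\<^sub>m n"
        by (intro eq_matI) (auto simp: ev_def)
      then show "ev t G * ev t H = poly D t \<cdot>\<^sub>m 1\<^sub>m n" "ev t H * ev t G = poly D t \<cdot>\<^sub>m 1\<^sub>m n"
        using poly_eval_mat_mult[OF GTH(1) GTH(3), of t, folded ev_def]
          poly_eval_mat_mult[OF GTH(3) GTH(1), of t, folded ev_def] GTH(4,5)
        by (simp_all add: ev_def)
    qed
    have det_ev: "det (ev t G) = poly D t" for t
      unfolding D_def by (rule poly_det_cong[symmetric, of _ n]) (use GTH ev_car in \<open>auto simp: ev_def\<close>)
    define A where "A = (\<lambda>t. inverse (poly D t) \<cdot>\<^sub>m (ev t G * ev t T * ev t H))"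
    \<comment> \<open>Where \<open>G\<close> is invertible the conjugation equation has one
      solution; this later identifies \<open>A0\<close> and \<open>A1\<close> with the curve at
      parameters 0 and 1.\<close>
    have A_uniq: "X = A t" if "poly D t \<noteq> 0" "X \<in> carrier_mat n n" "X * ev t G = ev t G * ev t T" for X t
    proof -
      have "poly D t \<cdot>\<^sub>m X = ev t G * ev t T * ev t H"
        by (rule mat_cancel_right[OF _ _ GH(1)]) (use that GTH ev_car in \<open>auto intro!: mult_carrier_mat[of _ n n]\<close>)
      then have "A t = inverse (poly D t) \<cdot>\<^sub>m (poly D t \<cdot>\<^sub>m X)"
        unfolding A_def by simp
      also have "\<dots> = X"
        using that by (intro eq_matI) auto
      finally show ?thesis ..
    qed
    have A_conj: "A t \<in> conj_set n Gs Ts" if t: "poly D t \<noteq> 0" for t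
    proof -
      have "A t * ev t G = inverse (poly D t) \<cdot>\<^sub>m (ev t G * ev t T * ev t H * ev t G)"
        unfolding A_def by (rule mult_smult_assoc_mat[of _ n n _ n]) (use GTH ev_car in \<open>auto intro!: mult_carrier_mat[of _ n n]\<close>)
      also have "ev t G * ev t T * ev t H * ev t G = ev t G * ev t T * (ev t H * ev t G)"
        by (rule assoc_mult_mat[of _ n n _ n _ n]) (use GTH ev_car in \<open>auto intro!: mult_carrier_mat[of _ n n]\<close>)
      also have "\<dots> = poly D t \<cdot>\<^sub>m (ev t G * ev t T)"
        unfolding GH by (subst mult_smult_distrib[of _ n n _ n])
           (use GTH ev_car in \<open>auto intro!: mult_carrier_mat[of _ n n] right_mult_one_mat[of _ n n] arg_cong[of _ _ "smult_mat _"]\<close>)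
      also have "inverse (poly D t) \<cdot>\<^sub>m \<dots> = ev t G * ev t T"
        using t GTH ev_car by (intro eq_matI) auto
      finally have "A t * ev t G = ev t G * ev t T" .
      moreover have "ev t G \<in> Gs" "ev t T \<in> Ts"
        unfolding G_def T_def using Gs Ts 0 1 car ev_line unfolding line_closed_def by auto
      moreover have "A t \<in> carrier_mat n n"
        unfolding A_def by (intro smult_carrier_mat mult_carrier_mat[of _ n n] ev_car GTH)
      ultimately show ?thesis
        unfolding conj_set_def
        by (intro CollectI conjI bexI[of _ "ev t G"] bexI[of _ "ev t T"]) (use t det_ev in auto)
    qed
    define E where "E = (\<lambda>i j. (G * T * H) $$ (i, j))"
    have "A t $$ (i, j) * poly D t = poly (E i j) t" if "poly D t \<noteq> 0" "i < n" "j < n" for t i j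
    proof -
      have "ev t (G * T * H) = ev t G * ev t T * ev t H"
        unfolding ev_def by (subst poly_eval_mat_mult[of _ n], (intro mult_carrier_mat[of _ n n] GTH)+,
            subst poly_eval_mat_mult[of _ n]) (auto simp: GTH)
      then show ?thesis
        using that GTH unfolding A_def E_def by (simp flip: \<open>ev t (G * T * H) = _\<close>) (simp add: ev_def)
    qed
    note rat = polynomial_functions_on_rational_curve[of _ n D A E, OF _ this]
    obtain N P where P: "\<And>t. poly D t \<noteq> 0 \<Longrightarrow> p (A t) * poly D t ^ N = poly P t"
      using rat[OF p] by blast
    obtain M Q where Q: "\<And>t. poly D t \<noteq> 0 \<Longrightarrow> q (A t) * poly D t ^ M = poly Q t"
      using rat[OF q] by blast
    have ev01: "ev 0 G = G0" "ev 1 G = G1" "ev 0 T = T0" "ev 1 T = T1"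
      unfolding G_def T_def using car by (auto simp: ev_line intro!: eq_matI)
    have D01: "poly D 0 \<noteq> 0" "poly D 1 \<noteq> 0"
      using det_ev[of 0] det_ev[of 1] ev01 0 1 by auto
    have "A0 = A 0" "A1 = A 1"
      using A_uniq[of 0 A0] A_uniq[of 1 A1] D01 ev01 0 1 by auto
    then have "poly P 0 \<noteq> 0" "poly Q 1 \<noteq> 0"
      using P[of 0] Q[of 1] D01 A0 A1 by auto
    \<comment> \<open>\<open>P\<close> is nonzero at 0 and \<open>Q\<close> at 1, so all three
      factors are nonzero polynomials and have a common non-root.\<close>
    then have "D * P * Q \<noteq> 0"
      using D01 by auto
    then obtain t where "poly (D * P * Q) t \<noteq> 0"
      using poly_all_0_iff_0 by blast
    then have t: "poly D t \<noteq> 0" "poly P t \<noteq> 0" "poly Q t \<noteq> 0" by auto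
    then have "p (A t) \<noteq> 0" "q (A t) \<noteq> 0"
      using P[of t] Q[of t] by auto
    then show False
      using pq A_conj[OF t(1)] by auto
  qed
qed

section \<open>Matrices with prescribed characteristic polynomial\<close>

definition supported_on :: "nat \<Rightarrow> (nat \<times> nat) set \<Rightarrow> complex mat set" where
  "supported_on n M = {G \<in> carrier_mat n n. \<forall>i<n. \<forall>j<n. (i, j) \<notin> M \<longrightarrow> G $$ (i, j) = 0}"

definition diag_plus :: "complex list \<Rightarrow> (nat \<times> nat) set \<Rightarrow> complex mat set" where
  "diag_plus es N = {T \<in> carrier_mat (length es) (length es).
     \<forall>i<length es. \<forall>j<length es. (i = j \<longrightarrow> T $$ (i, j) = es ! i) \<and>
       (i \<noteq> j \<and> (i, j) \<notin> N \<longrightarrow> T $$ (i, j) = 0)}"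

definition strict_upper :: "(nat \<times> nat) set" where
  "strict_upper = {(i, j). i < j}"

text \<open>The variety of \<open>f\<close> in terms of a list of the roots of \<open>f\<close>. The
  order of the list prescribes the diagonal of the triangular matrices.\<close>

definition spectral_variety :: "complex list \<Rightarrow> complex mat set" where
  "spectral_variety es = {A \<in> carrier_mat (length es) (length es). char_poly A = (\<Prod>a\<leftarrow>es. [:- a, 1:])}"

lemma line_closed_supported_on: "line_closed n (supported_on n M)"
  unfolding line_closed_def supported_on_def by auto

lemma line_closed_diag_plus: "line_closed (length es) (diag_plus es N)"
  unfolding line_closed_def diag_plus_def by (auto simp: algebra_simps)

lemma line_closed_one: "line_closed n {1\<^sub>m n}"
  unfolding line_closed_def by (auto intro!: eq_matI)

lemma diag_plus_mono: "N \<subseteq> N' \<Longrightarrow> diag_plus es N \<subseteq> diag_plus es N'"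
  unfolding diag_plus_def by blast

lemma diag_plus_strict_upper_iff:
  assumes "T \<in> carrier_mat (length es) (length es)"
  shows "T \<in> diag_plus es strict_upper \<longleftrightarrow> upper_triangular T \<and> diag_mat T = es"
proof -
  have "length (diag_mat T) = length es" "\<And>i. i < length es \<Longrightarrow> diag_mat T ! i = T $$ (i, i)"
    using assms by (simp_all add: diag_mat_def)
  then have "diag_mat T = es \<longleftrightarrow> (\<forall>i<length es. T $$ (i, i) = es ! i)"
    by (metis nth_equalityI)
  moreover have "upper_triangular T \<longleftrightarrow> (\<forall>i<length es. \<forall>j<i. T $$ (i, j) = 0)"
    using assms by (auto simp: upper_triangular_def)
  moreover have "T \<in> diag_plus es strict_upper \<longleftrightarrow>
      (\<forall>i<length es. T $$ (i, i) = es ! i) \<and> (\<forall>i<length es. \<forall>j<i. T $$ (i, j) = 0)"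
    (is "?l \<longleftrightarrow> ?r")
  proof
    assume ?l
    then show ?r by (auto simp: diag_plus_def strict_upper_def)
  next
    assume ?r
    then show ?l using assms by (auto simp: diag_plus_def strict_upper_def not_less order_le_less)
  qed
  ultimately show ?thesis by (simp only: conj_commute)
qed

lemma conj_set_imp_similar:
  assumes "A \<in> carrier_mat n n" "G \<in> carrier_mat n n" "(T :: complex mat) \<in> carrier_mat n n"
    and "det G \<noteq> 0" "A * G = G * T"
  shows "similar_mat A T"
proof -
  define H where "H = inverse (det G) \<cdot>\<^sub>m adj_mat G"
  have H: "H \<in> carrier_mat n n" "G * H = 1\<^sub>m n"
    using adj_mat[OF assms(2)] assms by (auto simp: H_def mult_smult_distrib[of G n n _ n] intro!: eq_matI)
  have HG: "H * G = 1\<^sub>m n"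
    using mat_mult_left_right_inverse[OF assms(2) H] .
  have "A = 1 \<cdot>\<^sub>m A" by (intro eq_matI) auto
  also have "\<dots> = G * T * H"
    by (rule mat_cancel_right[OF assms(2) H(1)]) (use H assms in \<open>auto intro!: eq_matI mult_carrier_mat[of _ n n]\<close>)
  finally have "A = G * T * H" .
  then show ?thesis
    using H HG assms by (intro similar_matI[of _ _ G H n]) auto
qed

lemma similar_imp_conj:
  assumes "similar_mat A (T :: complex mat)" "A \<in> carrier_mat n n"
  obtains G where "G \<in> carrier_mat n n" "det G \<noteq> 0" "A * G = G * T" "T \<in> carrier_mat n n"
proof -
  from assms(1) obtain P Q where "similar_mat_wit A T P Q"
    unfolding similar_mat_def by blast
  from similar_mat_witD2[OF assms(2) this]
  have w: "P * Q = 1\<^sub>m n" "Q * P = 1\<^sub>m n" "A = P * T * Q" "T \<in> carrier_mat n n"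
    "P \<in> carrier_mat n n" "Q \<in> carrier_mat n n" by auto
  have "A * P = P * T * (Q * P)"
    unfolding w(3) using w(4-6) by (intro assoc_mult_mat[of _ n n _ n _ n]) (auto intro!: mult_carrier_mat[of _ n n])
  then have "A * P = P * T"
    using w mult_carrier_mat[OF w(5) w(4)] by simp
  moreover have "det P * det Q = 1"
    using w det_mult[of P n Q] by simp
  moreover from this have "det P \<noteq> 0" by auto
  ultimately show ?thesis
    using that[of P] w(4,5) by blast
qed

text \<open>One inclusion is the Schur decomposition with the eigenvalues in the order of
  \<open>es\<close>; the other holds because similar matrices have the same characteristic
  polynomial, which is read off the diagonal of a triangular one.\<close>

lemma spectral_variety_eq_conj_set:
  "spectral_variety es = conj_set (length es) (carrier_mat (length es) (length es)) (diag_plus es strict_upper)"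
proof (intro equalityI subsetI)
  fix A assume A: "A \<in> spectral_variety es"
  then have car: "A \<in> carrier_mat (length es) (length es)"
    unfolding spectral_variety_def by auto
  obtain B P Q where BPQ: "schur_decomposition A es = (B, P, Q)"
    by (cases "schur_decomposition A es")
  have "similar_mat_wit A B P Q \<and> upper_triangular B \<and> diag_mat B = es"
    by (rule schur_decomposition[OF car _ BPQ]) (use A in \<open>simp add: spectral_variety_def\<close>)
  moreover from this obtain G where "G \<in> carrier_mat (length es) (length es)" "det G \<noteq> 0" "A * G = G * B"
      "B \<in> carrier_mat (length es) (length es)"
    using similar_imp_conj[OF _ car] unfolding similar_mat_def by metis
  ultimately show "A \<in> conj_set (length es) (carrier_mat (length es) (length es)) (diag_plus es strict_upper)"
    unfolding conj_set_def using car diag_plus_strict_upper_iff[of B es] by blast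
next
  fix A assume "A \<in> conj_set (length es) (carrier_mat (length es) (length es)) (diag_plus es strict_upper)"
  then obtain G T where A: "A \<in> carrier_mat (length es) (length es)" "G \<in> carrier_mat (length es) (length es)"
    "T \<in> diag_plus es strict_upper" "det G \<noteq> 0" "A * G = G * T"
    unfolding conj_set_def by blast
  moreover have T: "T \<in> carrier_mat (length es) (length es)"
    using A unfolding diag_plus_def by blast
  ultimately have "char_poly A = char_poly T"
    by (intro char_poly_similar conj_set_imp_similar)
  also have "\<dots> = (\<Prod>a\<leftarrow>es. [:- a, 1:])"
    using A T char_poly_upper_triangular[OF T] by (simp add: diag_plus_strict_upper_iff)
  finally show "A \<in> spectral_variety es"
    using A unfolding spectral_variety_def by blast
qed

lemma diag_in_diag_plus:
  "mat (length es) (length es) (\<lambda>(i, j). if i = j then es ! i else 0) \<in> diag_plus es N"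
  unfolding diag_plus_def by auto

text \<open>Makes a family of triangular matrices a special case of a conjugated family, so that its
  primality follows from the same curve argument.\<close>

lemma conj_set_one:
  assumes "Ts \<subseteq> carrier_mat n n"
  shows "conj_set n {1\<^sub>m n} Ts = Ts"
proof (intro equalityI subsetI)
  fix A assume "A \<in> conj_set n {1\<^sub>m n} Ts"
  then obtain T where T: "A \<in> carrier_mat n n" "T \<in> Ts" "A * 1\<^sub>m n = 1\<^sub>m n * T"
    unfolding conj_set_def by blast
  then have "A = T" using assms by (metis left_mult_one_mat right_mult_one_mat subsetD)
  then show "A \<in> Ts" using T by simp
next
  fix A assume "A \<in> Ts"
  then show "A \<in> conj_set n {1\<^sub>m n} Ts"
    using assms unfolding conj_set_def by (auto intro!: bexI[of _ A] simp: subset_iff)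
qed

lemma diag_plus_subset_carrier: "diag_plus es N \<subseteq> carrier_mat (length es) (length es)"
  unfolding diag_plus_def by blast

lemma diag_plus_subset_conj_set:
  assumes "1\<^sub>m (length es) \<in> Gs"
  shows "diag_plus es N \<subseteq> conj_set (length es) Gs (diag_plus es N)"
  using conj_set_mono[of "{1\<^sub>m (length es)}" Gs "diag_plus es N" "diag_plus es N" "length es"] assms
  by (simp add: conj_set_one[OF diag_plus_subset_carrier])

lemma prime_set_conj_set_diag_plus:
  assumes "line_closed (length es) Gs" "1\<^sub>m (length es) \<in> Gs"
  shows "prime_set (length es) (conj_set (length es) Gs (diag_plus es N))"
  using diag_plus_subset_conj_set[OF assms(2)] diag_in_diag_plus[of es N]
  by (intro prime_set_conj_set assms line_closed_diag_plus) auto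

lemma line_closed_carrier: "line_closed n (carrier_mat n n)"
  unfolding line_closed_def by auto

text \<open>The equations compare values instead of coefficients: one equation
  \<open>det (c - A) = cp(c)\<close> for each complex \<open>c\<close>. Together they force equality
  of polynomials, as the field is infinite.\<close>

lemma algebraic_set_spectral_variety: "algebraic_set (length es) (spectral_variety es)"
proof -
  define n where "n = length es"
  define cp where "cp = (\<Prod>a\<leftarrow>es. [:- a, 1:])"
  define p where "p = (\<lambda>c A. det (mat n n (\<lambda>(i, j). (if i = j then c else 0) - A $$ (i, j))) - poly cp c)"
  have p_eval: "p c A = poly (char_poly A - cp) c" if A: "A \<in> carrier_mat n n" for A c
  proof -
    have "mat n n (\<lambda>(i, j). (if i = j then c else 0) - A $$ (i, j)) = - char_matrix A c"
      using A by (intro eq_matI) (auto simp: char_matrix_def)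
    then show ?thesis
      using A by (simp add: p_def char_poly_matrix[of A n c])
  qed
  have "p c \<in> polynomial_functions n" for c
    unfolding p_def
    by (intro polynomial_functions_diff polynomial_functions_det polynomial_functions.const
        polynomial_functions.entry)
  moreover have "spectral_variety es = {A \<in> carrier_mat n n. \<forall>q\<in>range p. q A = 0}"
  proof -
    have "char_poly A = cp \<longleftrightarrow> (\<forall>c. p c A = 0)" if "A \<in> carrier_mat n n" for A
      using that p_eval poly_all_0_iff_0[of "char_poly A - cp"] by simp
    then show ?thesis
      unfolding spectral_variety_def n_def[symmetric] cp_def[symmetric] by auto
  qed
  ultimately show ?thesis
    unfolding algebraic_set_def n_def[symmetric] by blast
qed

lemma irreducible_spectral_variety: "absolutely_irreducible_variety (length es) (spectral_variety es)"
proof -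
  have "prime_set (length es) (spectral_variety es)"
    unfolding spectral_variety_eq_conj_set
    by (rule prime_set_conj_set_diag_plus) (simp_all add: line_closed_carrier)
  then show ?thesis
    using prime_set_zclosure_irreducible zclosure_algebraic_set[OF algebraic_set_spectral_variety] by metis
qed

section \<open>Non-linearity\<close>

lemma eigenvalue_spectral_variety:
  assumes "A \<in> spectral_variety es" "v \<in> carrier_vec (length es)" "v \<noteq> 0\<^sub>v (length es)" "A *\<^sub>v v = \<mu> \<cdot>\<^sub>v v"
  shows "\<mu> \<in> set es"
proof -
  have A: "A \<in> carrier_mat (length es) (length es)" "char_poly A = (\<Prod>a\<leftarrow>es. [:- a, 1:])"
    using assms(1) unfolding spectral_variety_def by auto
  have "eigenvalue A \<mu>"
    unfolding eigenvalue_def eigenvector_def using assms A by auto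
  then have "poly (\<Prod>a\<leftarrow>es. [:- a, 1:]) \<mu> = 0"
    using eigenvalue_root_char_poly[OF A(1)] A(2) by simp
  then show ?thesis
    by (auto simp: poly_prod_list prod_list_zero_iff)
qed

lemma spectral_variety_not_affine:
  assumes "length es \<ge> 2"
  shows "\<not> affine_linear_subspace (length es) (spectral_variety es)"
proof
  define n where "n = length es"
  have n: "0 < n" "1 < n" using assms n_def by auto
  define D where "D = (\<lambda>x y. mat n n (\<lambda>(i, j). if i = j then es ! i else
      if i = 0 \<and> j = 1 then x else if i = 1 \<and> j = 0 then y else (0 :: complex)))"
  have D_car [simp]: "D x y \<in> carrier_mat n n" for x y by (simp add: D_def)
  have "diag_mat (D x y) = es" for x y
    by (rule nth_equalityI) (simp_all add: diag_mat_def D_def n_def)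
  moreover have "upper_triangular (D x 0)" for x
    by (auto simp: upper_triangular_def D_def)
  ultimately have D1: "D x 0 \<in> spectral_variety es" for x
    using char_poly_upper_triangular[OF D_car, of x 0] D_car[of x 0] unfolding spectral_variety_def n_def by simp
  have "transpose_mat (D x 0) = D 0 x" for x
    by (intro eq_matI) (auto simp: D_def)
  then have D2: "D 0 x \<in> spectral_variety es" for x
    using D1[of x] char_poly_transpose_mat[of "D x 0" n] D_car[of 0 x]
    unfolding spectral_variety_def n_def[symmetric] by simp
  assume "affine_linear_subspace (length es) (spectral_variety es)"
  then obtain A W where A: "A \<in> carrier_mat n n" and W: "linear_subspace n W"
    and eq: "spectral_variety es = (\<lambda>B. A + B) ` W"
    unfolding affine_linear_subspace_def n_def by blast
  have D3: "D c c \<in> spectral_variety es" for c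
  proof -
    from D1[of 0] D1[of c] D2[of c] obtain X Y Z where
      XYZ: "X \<in> W" "D 0 0 = A + X" "Y \<in> W" "D c 0 = A + Y" "Z \<in> W" "D 0 c = A + Z"
      unfolding eq by blast
    have car: "X \<in> carrier_mat n n" "Y \<in> carrier_mat n n" "Z \<in> carrier_mat n n"
      using W XYZ unfolding linear_subspace_def by auto
    \<comment> \<open>\<open>D c c\<close> is \<open>D c 0 + D 0 c - D 0 0\<close>. The coefficients
      sum to 1, so the base point \<open>A\<close> occurs exactly once and this displacement has to
      lie in \<open>W\<close>.\<close>
    have "Y + Z + (-1) \<cdot>\<^sub>m X \<in> W"
      using W XYZ unfolding linear_subspace_def by blast
    moreover have "D c c = A + (Y + Z + (-1) \<cdot>\<^sub>m X)"
    proof (rule eq_matI)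
      fix i j assume "i < dim_row (A + (Y + Z + (-1) \<cdot>\<^sub>m X))" "j < dim_col (A + (Y + Z + (-1) \<cdot>\<^sub>m X))"
      then have ij: "i < n" "j < n" using car A by auto
      have "D 0 0 $$ (i, j) = A $$ (i, j) + X $$ (i, j)" "D c 0 $$ (i, j) = A $$ (i, j) + Y $$ (i, j)"
        "D 0 c $$ (i, j) = A $$ (i, j) + Z $$ (i, j)"
        unfolding XYZ using ij car A by auto
      moreover have "D c c $$ (i, j) = D c 0 $$ (i, j) + D 0 c $$ (i, j) - D 0 0 $$ (i, j)"
        using ij by (auto simp: D_def)
      ultimately show "D c c $$ (i, j) = (A + (Y + Z + (-1) \<cdot>\<^sub>m X)) $$ (i, j)"
        using ij car A by simp
    qed (use car A in \<open>simp_all add: D_def\<close>)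
    ultimately show ?thesis unfolding eq by blast
  qed
  have "infinite (UNIV - set es :: complex set)"
    by (simp add: infinite_UNIV_char_0)
  then have "UNIV - set es \<noteq> {}" by (metis finite.emptyI)
  then obtain \<mu> where \<mu>: "\<mu> \<notin> set es" by blast
  define a b where "a = es ! 0" and "b = es ! 1"
  \<comment> \<open>The leading 2 by 2 block of \<open>D c c\<close> has diagonal \<open>a\<close>,
    \<open>b\<close> and characteristic polynomial \<open>(X - a) * (X - b) - c^2\<close>; this
    \<open>c\<close> makes \<mu> a root of it.\<close>
  define c where "c = csqrt ((\<mu> - a) * (\<mu> - b))"
  have c: "c * c = (\<mu> - a) * (\<mu> - b)"
    unfolding c_def by (metis power2_csqrt power2_eq_square)
  \<comment> \<open>An eigenvector of that block for \<mu>, padded by zeros. Its second coordinate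
    is nonzero because \<mu> is not in \<open>es\<close>.\<close>
  define v where "v = vec n (\<lambda>i. if i = 0 then c else if i = 1 then \<mu> - a else 0)"
  have "\<mu> \<noteq> a"
    using \<mu> n unfolding a_def n_def by auto
  then have "v $ 1 \<noteq> 0" using n by (simp add: v_def)
  then have "v \<noteq> 0\<^sub>v n" using n by auto
  moreover have "D c c *\<^sub>v v = \<mu> \<cdot>\<^sub>v v"
  proof (rule eq_vecI)
    fix i assume "i < dim_vec (\<mu> \<cdot>\<^sub>v v)"
    then have i: "i < n" by (simp add: v_def)
    have "(D c c *\<^sub>v v) $ i = (\<Sum>j\<in>{0..<n}. D c c $$ (i, j) * v $ j)"
      using i D_car[of c c] by (simp add: scalar_prod_def v_def carrier_matD[OF D_car])
    also have "\<dots> = (\<Sum>j\<in>{0, 1}. D c c $$ (i, j) * v $ j)"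
      by (rule sum.mono_neutral_right) (use n in \<open>auto simp: v_def\<close>)
    also have "\<dots> = D c c $$ (i, 0) * c + D c c $$ (i, 1) * (\<mu> - a)"
      using n by (simp add: v_def)
    also have "\<dots> = \<mu> * v $ i"
    proof -
      consider "i = 0" | "i = 1" | "i \<ge> 2" by linarith
      then show ?thesis
        using i n c by cases (auto simp: D_def v_def a_def b_def algebra_simps)
    qed
    finally show "(D c c *\<^sub>v v) $ i = (\<mu> \<cdot>\<^sub>v v) $ i"
      using i by (simp add: v_def)
  qed (simp add: v_def D_def)
  ultimately have "\<mu> \<in> set es"
    by (intro eigenvalue_spectral_variety[OF D3]) (auto simp: v_def n_def)
  then show False using \<mu> by blast
qed

section \<open>A long chain of irreducible subvarieties\<close>

definition irreducible_chain :: "nat \<Rightarrow> nat \<Rightarrow> complex mat set \<Rightarrow> bool" where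
  "irreducible_chain n k Z \<longleftrightarrow> (\<exists>C :: nat \<Rightarrow> complex mat set.
     (\<forall>i\<le>k. absolutely_irreducible_variety n (C i) \<and> C i \<subseteq> Z) \<and> (\<forall>i<k. C i \<subset> C (Suc i)))"

lemma irreducible_chain_mono: "irreducible_chain n k Z \<Longrightarrow> Z \<subseteq> Z' \<Longrightarrow> irreducible_chain n k Z'"
  unfolding irreducible_chain_def by (meson subset_trans)

lemma irreducible_chain_0: "prime_set n S \<Longrightarrow> irreducible_chain n 0 (zclosure n S)"
  unfolding irreducible_chain_def
  by (rule exI[of _ "\<lambda>_. zclosure n S"]) (simp add: prime_set_zclosure_irreducible)

text \<open>The function \<open>p\<close> vanishes on the closure of \<open>S\<close> but not at
  \<open>B\<close>, so the closure of \<open>S'\<close> is strictly larger and can be put on top of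
  the chain.\<close>

lemma irreducible_chain_Suc:
  assumes chain: "irreducible_chain n k (zclosure n S)" and "S \<subseteq> S'" and "prime_set n S'"
    and "p \<in> polynomial_functions n" "\<forall>A\<in>S. p A = 0" "B \<in> S'" "p B \<noteq> 0"
  shows "irreducible_chain n (Suc k) (zclosure n S')"
proof -
  obtain C where C: "\<And>i. i \<le> k \<Longrightarrow> absolutely_irreducible_variety n (C i) \<and> C i \<subseteq> zclosure n S"
    "\<And>i. i < k \<Longrightarrow> C i \<subset> C (Suc i)"
    using chain unfolding irreducible_chain_def by blast
  have "zclosure n S \<subseteq> zclosure n S'" "B \<in> zclosure n S'" "B \<notin> zclosure n S"
    using assms zclosure_mono[of S S' n] zclosure_superset[of S' n]
    unfolding prime_set_def by (auto simp: zclosure_def)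
  then have sub: "zclosure n S \<subset> zclosure n S'" by blast
  define C' where "C' = (\<lambda>i. if i \<le> k then C i else zclosure n S')"
  have "absolutely_irreducible_variety n (C' i) \<and> C' i \<subseteq> zclosure n S'" for i
    using C(1)[of i] sub prime_set_zclosure_irreducible[OF assms(3)] unfolding C'_def by auto
  moreover have "C' i \<subset> C' (Suc i)" if "i < Suc k" for i
    using that C(1)[of i] C(2)[of i] sub unfolding C'_def by (cases "i = k") auto
  ultimately show ?thesis
    unfolding irreducible_chain_def by blast
qed

section \<open>Lower half of the chain: triangular matrices\<close>

lemma irreducible_chain_diag_plus:
  assumes "finite N" "N \<subseteq> {(i, j). i < j \<and> j < length es}"
  shows "irreducible_chain (length es) (card N) (zclosure (length es) (diag_plus es N))"
  using assms
proof (induction N)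
  have prime: "prime_set (length es) (diag_plus es N)" for N
    using prime_set_conj_set_diag_plus[OF line_closed_one, of es N]
    by (simp add: conj_set_one[OF diag_plus_subset_carrier])
  {
    case empty
    show ?case using irreducible_chain_0[OF prime] by simp
  next
    case (insert x N)
    obtain i j where x: "x = (i, j)" by (cases x)
    then have ij: "i < j" "j < length es" "(i, j) \<notin> N" using insert by auto
    define B where "B = mat (length es) (length es)
      (\<lambda>(a, b). if a = b then es ! a else if a = i \<and> b = j then 1 else 0)"
    have "irreducible_chain (length es) (Suc (card N)) (zclosure (length es) (diag_plus es (insert x N)))"
    proof (rule irreducible_chain_Suc[where p = "\<lambda>A. A $$ (i, j)" and B = B and S = "diag_plus es N"])
      show "irreducible_chain (length es) (card N) (zclosure (length es) (diag_plus es N))"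
        using insert by blast
      show "diag_plus es N \<subseteq> diag_plus es (insert x N)"
        by (rule diag_plus_mono) blast
      show "(\<lambda>A. A $$ (i, j)) \<in> polynomial_functions (length es)"
        using ij by (intro polynomial_functions.entry) auto
      show "\<forall>A\<in>diag_plus es N. A $$ (i, j) = 0"
        using ij unfolding diag_plus_def by auto
      show "B \<in> diag_plus es (insert x N)"
        unfolding diag_plus_def x B_def by auto
      show "B $$ (i, j) \<noteq> 0"
        using ij by (simp add: B_def)
    qed (rule prime)
    then show ?case using insert by simp
  }
qed

section \<open>Upper half of the chain: flag strata\<close>

definition column_pattern :: "nat \<Rightarrow> nat \<Rightarrow> (nat \<times> nat) set" where
  "column_pattern k r = {(a, b). a = b \<or> (k < b \<and> k \<le> a) \<or> (b = k \<and> k \<le> a \<and> a \<le> r)}"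

text \<open>Since \<open>A * G = G * T\<close>, the leading columns of \<open>G\<close> span a flag
  invariant under \<open>A\<close>. The pattern makes the first \<open>k\<close> columns multiples
  of unit vectors and confines the next one to the rows \<open>k..r\<close>. With \<open>r\<close>
  the last row, the stratum for \<open>Suc k\<close> lies in the one for \<open>k\<close>,
  \<open>k\<close>; with \<open>k = 0\<close> in addition, every invertible \<open>G\<close> is
  allowed.\<close>

definition flag_stratum :: "complex list \<Rightarrow> nat \<Rightarrow> nat \<Rightarrow> complex mat set" where
  "flag_stratum es k r = conj_set (length es)
     (supported_on (length es) (column_pattern k r)) (diag_plus es strict_upper)"

text \<open>The minor of \<open>A - es ! k\<close> with rows \<open>Suc k..Suc r\<close> and columns
  \<open>k..r\<close>. Rows start one later than columns, so diagonal entries of the full matrix sit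
  where \<open>Suc a = b\<close>.\<close>

definition flag_minor :: "complex list \<Rightarrow> nat \<Rightarrow> nat \<Rightarrow> complex mat \<Rightarrow> complex" where
  "flag_minor es k r = (\<lambda>A. det (mat (Suc r - k) (Suc r - k)
     (\<lambda>(a, b). A $$ (Suc (k + a), k + b) - (if Suc a = b then es ! k else 0))))"

lemma one_mem_supported_on_column_pattern: "1\<^sub>m n \<in> supported_on n (column_pattern k r)"
  unfolding supported_on_def column_pattern_def by auto

lemma prime_set_flag_stratum: "prime_set (length es) (flag_stratum es k r)"
  unfolding flag_stratum_def
  by (intro prime_set_conj_set_diag_plus line_closed_supported_on one_mem_supported_on_column_pattern)

lemma flag_stratum_mono:
  assumes "\<And>a b. a < length es \<Longrightarrow> b < length es \<Longrightarrow> (a, b) \<in> column_pattern k r \<Longrightarrow>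
    (a, b) \<in> column_pattern k' r'"
  shows "flag_stratum es k r \<subseteq> flag_stratum es k' r'"
  unfolding flag_stratum_def
  by (intro conj_set_mono order.refl) (use assms in \<open>auto simp: supported_on_def\<close>)

lemma flag_minor_polynomial:
  assumes "k \<le> r" "Suc r < n"
  shows "flag_minor es k r \<in> polynomial_functions n"
  unfolding flag_minor_def
  by (intro polynomial_functions_det polynomial_functions_diff polynomial_functions.const
      polynomial_functions.entry) (use assms in auto)

lemma mat_mult_entry:
  assumes "A \<in> carrier_mat n n" "B \<in> carrier_mat n n" "i < n" "j < n"
  shows "(A * B) $$ (i, j) = (\<Sum>c<n. A $$ (i, c) * B $$ (c, j))"
  using assms by (auto simp: scalar_prod_def lessThan_atLeast0)

text \<open>The column \<open>k\<close> of \<open>G\<close> is a vector supported on the rows \<open>k..r\<close>, and \<open>A - es ! k\<close> maps it to a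
  vector supported on the rows before \<open>k\<close>; so it gives a kernel vector of the minor.\<close>

lemma flag_minor_vanishes:
  assumes kr: "k \<le> r" "Suc r < length es" and A: "A \<in> flag_stratum es k r"
  shows "flag_minor es k r A = 0"
proof -
  define n where "n = length es"
  define m where "m = Suc r - k"
  have m: "Suc (r - k) = m" using kr unfolding m_def by auto
  obtain G T where AGT: "A \<in> carrier_mat n n" "G \<in> supported_on n (column_pattern k r)"
    "T \<in> diag_plus es strict_upper" "det G \<noteq> 0" "A * G = G * T"
    using A unfolding flag_stratum_def conj_set_def n_def by blast
  have G: "G \<in> carrier_mat n n" "\<And>a b. a < n \<Longrightarrow> b < n \<Longrightarrow> (a, b) \<notin> column_pattern k r \<Longrightarrow> G $$ (a, b) = 0"
    using AGT unfolding supported_on_def by auto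
  have T: "T \<in> carrier_mat n n" "\<And>i. i < n \<Longrightarrow> T $$ (i, i) = es ! i"
    "\<And>i j. i < n \<Longrightarrow> j < i \<Longrightarrow> T $$ (i, j) = 0"
    using AGT unfolding diag_plus_def strict_upper_def n_def by auto
  define M where "M = mat m m (\<lambda>(a, b). A $$ (Suc (k + a), k + b) - (if Suc a = b then es ! k else 0))"
  define v where "v = vec m (\<lambda>b. G $$ (k + b, k))"
  have k: "k < n" using kr n_def by auto
  have G0: "G $$ (c, k) = 0" if "c < n" "c < k \<or> r < c" for c
    using that k kr by (intro G) (auto simp: column_pattern_def)
  \<comment> \<open>Otherwise the whole column \<open>k\<close> of \<open>G\<close> would be zero,
    against \<open>det G \<noteq> 0\<close>.\<close>
  have "v \<noteq> 0\<^sub>v m"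
  proof
    assume "v = 0\<^sub>v m"
    then have "G $$ (k + b, k) = 0" if "b < m" for b
      using that by (metis index_vec index_zero_vec(1) v_def)
    moreover have "\<exists>b<m. c = k + b" if "k \<le> c" "c \<le> r" for c
      using that by (intro exI[of _ "c - k"]) (auto simp: m_def)
    ultimately have col: "G $$ (c, k) = 0" if "c < n" for c
      using that G0[of c] by (metis not_less)
    have "G *\<^sub>v unit_vec n k = 0\<^sub>v n"
      using G(1) k col by (intro eq_vecI) auto
    moreover have "unit_vec n k \<noteq> (0\<^sub>v n :: complex vec)"
      using k by (metis index_unit_vec(1) index_zero_vec(1) zero_neq_one)
    ultimately have "det G = 0"
      using det_0_iff_vec_prod_zero_field[OF G(1)] unit_vec_carrier by blast
    then show False using AGT by simp
  qed
  moreover have "M *\<^sub>v v = 0\<^sub>v m"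
  proof (rule eq_vecI)
    fix a assume "a < dim_vec (0\<^sub>v m :: complex vec)"
    then have a: "a < m" by simp
    define i where "i = Suc (k + a)"
    have i: "i < n" "k < i" "i \<le> Suc r" using a kr unfolding i_def m_def n_def by auto
    have "(M *\<^sub>v v) $ a = (\<Sum>b<m. M $$ (a, b) * G $$ (k + b, k))"
      using a by (simp add: M_def v_def scalar_prod_def lessThan_atLeast0)
    also have "\<dots> = (\<Sum>b<m. A $$ (i, k + b) * G $$ (k + b, k)) -
        (\<Sum>b<m. if Suc a = b then es ! k * G $$ (k + b, k) else 0)"
      unfolding sum_subtractf[symmetric] using a
      by (intro sum.cong refl) (auto simp: M_def i_def algebra_simps)
    \<comment> \<open>In the last row, \<open>i = Suc r\<close>, no index \<open>b\<close> matches;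
      the formula persists because \<open>G\<close> vanishes at \<open>(Suc r, k)\<close>.\<close>
    also have "(\<Sum>b<m. if Suc a = b then es ! k * G $$ (k + b, k) else 0) = es ! k * G $$ (i, k)"
    proof (cases "Suc a < m")
      case True
      then show ?thesis by (simp add: i_def)
    next
      case False
      then have "i = Suc r" using a unfolding i_def m_def by auto
      then show ?thesis using False i G0[of i] by simp
    qed
    also have "(\<Sum>b<m. A $$ (i, k + b) * G $$ (k + b, k)) = (\<Sum>c\<in>{k..r}. A $$ (i, c) * G $$ (c, k))"
      by (rule sum.reindex_bij_witness[of _ "\<lambda>c. c - k" "\<lambda>b. k + b"]) (auto simp: m_def)
    also have "\<dots> = (\<Sum>c<n. A $$ (i, c) * G $$ (c, k))"
      by (rule sum.mono_neutral_left) (use kr G0 in \<open>auto simp: n_def not_le\<close>)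
    also have "\<dots> = (A * G) $$ (i, k)"
      using AGT G i k by (intro mat_mult_entry[symmetric])
    also have "\<dots> = (\<Sum>c<n. G $$ (i, c) * T $$ (c, k))"
      unfolding AGT(5) using G i k T by (intro mat_mult_entry)
    \<comment> \<open>For \<open>c < k\<close> column \<open>c\<close> of \<open>G\<close> is zero
      off the diagonal and \<open>i > k\<close>; for \<open>c > k\<close> the entry of
      \<open>T\<close> lies below the diagonal.\<close>
    also have "\<dots> = (\<Sum>c\<in>{k}. G $$ (i, c) * T $$ (c, k))"
    proof (rule sum.mono_neutral_right)
      show "\<forall>c\<in>{..<n} - {k}. G $$ (i, c) * T $$ (c, k) = 0"
      proof
        fix c assume c: "c \<in> {..<n} - {k}"
        show "G $$ (i, c) * T $$ (c, k) = 0"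
        proof (cases "c < k")
          case True
          then have "G $$ (i, c) = 0"
            using c i by (intro G) (auto simp: column_pattern_def)
          then show ?thesis by simp
        next
          case False
          then show ?thesis using c T(3)[of c k] by auto
        qed
      qed
    qed (use k in auto)
    also have "\<dots> = es ! k * G $$ (i, k)"
      using T k by simp
    finally show "(M *\<^sub>v v) $ a = 0\<^sub>v m $ a"
      using a by simp
  qed (simp add: M_def)
  moreover have "M \<in> carrier_mat m m" "v \<in> carrier_vec m"
    by (simp_all add: M_def v_def)
  ultimately have "det M = 0"
    using det_0_iff_vec_prod_zero_field by blast
  then show ?thesis
    unfolding flag_minor_def M_def m_def by simp
qed

text \<open>Conjugating \<open>diag es\<close> plus the superdiagonal of ones by the reversal of \<open>k..Suc r\<close> turns the
  superdiagonal into the subdiagonal there, which makes the minor unitriangular.\<close>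

lemma flag_minor_witness:
  assumes kr: "k \<le> r" "Suc r < length es"
  shows "\<exists>B\<in>flag_stratum es k (Suc r). flag_minor es k r B \<noteq> 0"
proof -
  define n where "n = length es"
  define \<sigma> where "\<sigma> = (\<lambda>i. if k \<le> i \<and> i \<le> Suc r then k + Suc r - i else i)"
  have \<sigma>\<sigma>: "\<sigma> (\<sigma> i) = i" for i unfolding \<sigma>_def using kr by auto
  have \<sigma>n: "\<sigma> i < n" if "i < n" for i unfolding \<sigma>_def n_def using kr that n_def by auto
  have \<sigma>_eq: "i = \<sigma> j \<longleftrightarrow> j = \<sigma> i" for i j using \<sigma>\<sigma> by metis
  define T :: "complex mat" where
    "T = mat n n (\<lambda>(i, j). if i = j then es ! i else if j = Suc i then 1 else 0)"
  define G :: "complex mat" where "G = mat n n (\<lambda>(i, j). if i = \<sigma> j then 1 else 0)"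
  \<comment> \<open>This is \<open>G * T * G\<close>, where \<open>G\<close> is the permutation
    matrix of the involution \<sigma> and hence its own inverse.\<close>
  define B where "B = mat n n (\<lambda>(i, j). T $$ (\<sigma> i, \<sigma> j))"
  have car: "T \<in> carrier_mat n n" "G \<in> carrier_mat n n" "B \<in> carrier_mat n n"
    by (simp_all add: T_def G_def B_def)
  have T: "T \<in> diag_plus es strict_upper"
    unfolding diag_plus_def strict_upper_def T_def n_def by auto
  \<comment> \<open>The entry at \<open>(Suc r, k)\<close> is the only nonzero one outside the
    pattern for \<open>r\<close>.\<close>
  have Gs: "G \<in> supported_on n (column_pattern k (Suc r))"
    unfolding supported_on_def column_pattern_def G_def \<sigma>_def using kr by auto
  have mult_G: "(X * G) $$ (i, j) = X $$ (i, \<sigma> j)" if "X \<in> carrier_mat n n" "i < n" "j < n" for X i j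
  proof -
    have "(X * G) $$ (i, j) = (\<Sum>c<n. X $$ (i, c) * G $$ (c, j))"
      using that car by (intro mat_mult_entry)
    also have "\<dots> = (\<Sum>c<n. if c = \<sigma> j then X $$ (i, c) else 0)"
      using that by (intro sum.cong refl) (auto simp: G_def)
    finally show ?thesis using \<sigma>n[OF that(3)] by simp
  qed
  have G_mult: "(G * X) $$ (i, j) = X $$ (\<sigma> i, j)" if "X \<in> carrier_mat n n" "i < n" "j < n" for X i j
  proof -
    have "(G * X) $$ (i, j) = (\<Sum>c<n. G $$ (i, c) * X $$ (c, j))"
      using that car by (intro mat_mult_entry)
    also have "\<dots> = (\<Sum>c<n. if c = \<sigma> i then X $$ (c, j) else 0)"
      using that \<sigma>_eq[of i] by (intro sum.cong refl) (simp add: G_def)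
    finally show ?thesis using \<sigma>n[OF that(2)] by simp
  qed
  have "G * G = 1\<^sub>m n"
  proof (rule eq_matI)
    fix i j assume "i < dim_row (1\<^sub>m n)" "j < dim_col (1\<^sub>m n)"
    then have ij: "i < n" "j < n" by auto
    show "(G * G) $$ (i, j) = 1\<^sub>m n $$ (i, j)"
      unfolding mult_G[OF car(2) ij] using ij \<sigma>n by (auto simp: G_def \<sigma>\<sigma>)
  qed (use car in auto)
  then have "det G * det G = 1" using det_mult[OF car(2) car(2)] by simp
  then have "det G \<noteq> 0" by auto
  moreover have "B * G = G * T"
  proof (rule eq_matI)
    fix i j assume "i < dim_row (G * T)" "j < dim_col (G * T)"
    then have ij: "i < n" "j < n" using car by auto
    show "(B * G) $$ (i, j) = (G * T) $$ (i, j)"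
      unfolding mult_G[OF car(3) ij] G_mult[OF car(1) ij] using ij \<sigma>n by (simp add: B_def \<sigma>\<sigma>)
  qed (use car in auto)
  ultimately have B: "B \<in> flag_stratum es k (Suc r)"
    using T Gs car unfolding flag_stratum_def conj_set_def n_def by blast
  define m where "m = Suc r - k"
  define M where "M = mat m m (\<lambda>(a, b). B $$ (Suc (k + a), k + b) - (if Suc a = b then es ! k else 0))"
  have M_entry: "M $$ (a, b) = T $$ (r - a, Suc r - b) - (if Suc a = b then es ! k else 0)"
    if "a < m" "b < m" for a b
  proof -
    have "\<sigma> (Suc (k + a)) = r - a" "\<sigma> (k + b) = Suc r - b" "Suc (k + a) < n" "k + b < n"
      using that kr unfolding \<sigma>_def m_def n_def by auto
    then show ?thesis using that by (simp add: M_def B_def)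
  qed
  have bounds: "r - a < n" "Suc r - b < n" for a b
    using kr unfolding n_def by auto
  \<comment> \<open>Diagonal positions of \<open>M\<close> hit the superdiagonal of
    \<open>T\<close>; positions below the diagonal of \<open>M\<close> land beyond it, where
    \<open>T\<close> is zero.\<close>
  have "M $$ (a, a) = 1" if "a < m" for a
  proof -
    have "Suc r - a = Suc (r - a)" using that kr unfolding m_def by auto
    then show ?thesis
      using M_entry[OF that that] bounds(1)[of a] bounds(2)[of a] unfolding T_def by simp
  qed
  moreover have "M $$ (a, b) = 0" if "b < a" "a < m" for a b
  proof -
    have "Suc r - b > Suc (r - a)" using that kr unfolding m_def by auto
    then show ?thesis
      using that M_entry[of a b] bounds(1)[of a] bounds(2)[of b] unfolding T_def by simp
  qed
  moreover have Mcar: "M \<in> carrier_mat m m" by (simp add: M_def)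
  ultimately have "upper_triangular M" "diag_mat M = replicate m 1"
    by (auto simp: upper_triangular_def diag_mat_def intro!: nth_equalityI)
  then have "det M = 1"
    using det_upper_triangular[OF _ Mcar] by simp
  then have "flag_minor es k r B \<noteq> 0"
    unfolding flag_minor_def M_def m_def by simp
  then show ?thesis using B by blast
qed

lemma irreducible_chain_flag_stratum_Suc:
  assumes "k \<le> r" "Suc r < length es"
    and "irreducible_chain (length es) c (zclosure (length es) (flag_stratum es k r))"
  shows "irreducible_chain (length es) (Suc c) (zclosure (length es) (flag_stratum es k (Suc r)))"
proof -
  obtain B where B: "B \<in> flag_stratum es k (Suc r)" "flag_minor es k r B \<noteq> 0"
    using flag_minor_witness[OF assms(1,2)] by blast
  show ?thesis
  proof (rule irreducible_chain_Suc[OF assms(3) _ prime_set_flag_stratum flag_minor_polynomial _ B])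
    show "flag_stratum es k r \<subseteq> flag_stratum es k (Suc r)"
      by (rule flag_stratum_mono) (auto simp: column_pattern_def)
    show "\<forall>A\<in>flag_stratum es k r. flag_minor es k r A = 0"
      using flag_minor_vanishes assms by blast
  qed (use assms in auto)
qed

lemma irreducible_chain_flag_stratum_add:
  assumes "k + d < length es"
    and "irreducible_chain (length es) c (zclosure (length es) (flag_stratum es k k))"
  shows "irreducible_chain (length es) (c + d) (zclosure (length es) (flag_stratum es k (k + d)))"
  using assms
proof (induction d)
  case (Suc d)
  then show ?case
    using irreducible_chain_flag_stratum_Suc[of k "k + d" es "c + d"] by simp
qed simp

text \<open>The columns of \<open>G\<close> are opened from right to left, each from the diagonal
  downwards. The column with \<open>i\<close> rows below its diagonal entry contributes
  \<open>i\<close> strict steps.\<close>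

lemma irreducible_chain_flag_stratum:
  assumes "m < length es"
    and "irreducible_chain (length es) c (zclosure (length es) (diag_plus es strict_upper))"
  shows "irreducible_chain (length es) (c + (\<Sum>i\<le>m. i))
    (zclosure (length es) (flag_stratum es (length es - Suc m) (length es - 1)))"
  using assms(1)
proof (induction m)
  case 0
  have "diag_plus es strict_upper \<subseteq> flag_stratum es (length es - 1) (length es - 1)"
    unfolding flag_stratum_def
    by (intro diag_plus_subset_conj_set one_mem_supported_on_column_pattern)
  then show ?case
    using assms(2) irreducible_chain_mono zclosure_mono by (auto; blast)
next
  case (Suc m)
  define k where "k = length es - Suc (Suc m)"
  have k: "length es - Suc m = Suc k" "k + Suc m = length es - 1"
    using Suc.prems unfolding k_def by auto
  have "flag_stratum es (Suc k) (length es - 1) \<subseteq> flag_stratum es k k"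
    by (rule flag_stratum_mono) (auto simp: column_pattern_def)
  then have "irreducible_chain (length es) (c + (\<Sum>i\<le>m. i)) (zclosure (length es) (flag_stratum es k k))"
    using Suc k irreducible_chain_mono zclosure_mono by (metis Suc_lessD)
  from irreducible_chain_flag_stratum_add[OF _ this, of "Suc m"] show ?case
    using Suc.prems k unfolding k_def[symmetric] by (simp add: add.assoc)
qed

lemma card_strict_upper: "card {(i, j). i < j \<and> j < (n :: nat)} = (\<Sum>j<n. j)"
proof -
  have "bij_betw prod.swap {(i, j). i < j \<and> j < n} (SIGMA j:{..<n}. {..<j})"
    by (rule bij_betwI[of _ _ _ prod.swap]) auto
  then show ?thesis
    by (simp add: bij_betw_same_card)
qed

lemma finite_strict_upper: "finite {(i, j). i < j \<and> j < (n :: nat)}"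
  by (rule finite_subset[of _ "{..<n} \<times> {..<n}"]) auto

text \<open>Freeing \<open>T\<close> and freeing \<open>G\<close> each give
  \<open>n * (n - 1) / 2\<close> steps, for \<open>n = length es\<close>. The closures stay in the
  variety because it is closed.\<close>

lemma irreducible_chain_spectral_variety:
  assumes "es \<noteq> []"
  shows "irreducible_chain (length es) ((length es)\<^sup>2 - length es) (spectral_variety es)"
proof -
  define n where "n = length es"
  define N where "N = {(i, j). i < j \<and> j < n}"
  have "diag_plus es N \<subseteq> diag_plus es strict_upper"
    by (rule diag_plus_mono) (auto simp: N_def strict_upper_def)
  then have "irreducible_chain n (card N) (zclosure n (diag_plus es strict_upper))"
    using irreducible_chain_diag_plus[of N es] irreducible_chain_mono zclosure_mono finite_strict_upper
    unfolding N_def n_def by blast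
  then have "irreducible_chain n (card N + (\<Sum>i\<le>n - 1. i)) (zclosure n (flag_stratum es (n - Suc (n - 1)) (n - 1)))"
    using irreducible_chain_flag_stratum[of "n - 1" es] assms unfolding n_def by simp
  moreover have "zclosure n (flag_stratum es (n - Suc (n - 1)) (n - 1)) \<subseteq> spectral_variety es"
  proof -
    have "flag_stratum es (n - Suc (n - 1)) (n - 1) \<subseteq> spectral_variety es"
      unfolding flag_stratum_def spectral_variety_eq_conj_set
      by (intro conj_set_mono order.refl) (auto simp: supported_on_def)
    then show ?thesis
      using zclosure_mono zclosure_algebraic_set[OF algebraic_set_spectral_variety[of es]]
      unfolding n_def by metis
  qed
  moreover have "card N + (\<Sum>i\<le>n - 1. i) = n\<^sup>2 - n"
  proof -
    have "{..n - 1} = {..<n}"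
      using assms unfolding n_def by (cases es) auto
    then have "card N + (\<Sum>i\<le>n - 1. i) = 2 * (\<Sum>i<n. i)"
      using card_strict_upper[of n] by (simp add: N_def)
    also have "\<dots> = n\<^sup>2 - n"
      by (induction n) (auto simp: power2_eq_square algebra_simps)
    finally show ?thesis .
  qed
  ultimately show ?thesis
    using irreducible_chain_mono unfolding n_def by metis
qed

section \<open>Monomials modulo the characteristic polynomial\<close>

text \<open>The linear span of \<open>B\<close> as functions on \<open>V\<close>: only values on
  \<open>V\<close> count, which replaces the quotient by the vanishing ideal of
  \<open>V\<close>.\<close>

inductive_set lspan :: "'a set \<Rightarrow> ('a \<Rightarrow> complex) set \<Rightarrow> ('a \<Rightarrow> complex) set"
  for V :: "'a set" and B :: "('a \<Rightarrow> complex) set" where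
  zero: "(\<And>A. A \<in> V \<Longrightarrow> f A = 0) \<Longrightarrow> f \<in> lspan V B"
| step: "f \<in> lspan V B \<Longrightarrow> b \<in> B \<Longrightarrow> (\<And>A. A \<in> V \<Longrightarrow> g A = f A + c * b A) \<Longrightarrow> g \<in> lspan V B"

lemma lspan_cong:
  assumes "f \<in> lspan V B" "\<And>A. A \<in> V \<Longrightarrow> g A = f A"
  shows "g \<in> lspan V B"
  using assms(1)
proof cases
  case zero
  then show ?thesis using assms(2) by (intro lspan.zero) simp
next
  case (step h b c)
  show ?thesis
    by (rule lspan.step[OF step(1,2), of g c]) (simp add: step(3) assms(2))
qed

lemma lspan_base: "b \<in> B \<Longrightarrow> b \<in> lspan V B"
  by (rule lspan.step[where f = "\<lambda>_. 0" and c = 1]) (simp_all add: lspan.zero)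

lemma lspan_add:
  assumes "g \<in> lspan V B" "f \<in> lspan V B"
  shows "(\<lambda>A. f A + g A) \<in> lspan V B"
  using assms
proof (induction g)
  case (zero g)
  show ?case by (rule lspan_cong[OF zero(2)]) (simp add: zero(1))
next
  case (step g b h c)
  show ?case
    by (rule lspan.step[OF step.IH[OF step.prems] step.hyps(2), of _ c]) (simp add: step.hyps(3))
qed

lemma lspan_scale:
  assumes "f \<in> lspan V B"
  shows "(\<lambda>A. c * f A) \<in> lspan V B"
  using assms
proof (induction f)
  case (zero f)
  then show ?case by (intro lspan.zero) simp
next
  case (step f b g d)
  show ?case
    by (rule lspan.step[OF step.IH step.hyps(2), of _ "c * d"]) (simp add: step.hyps(3) algebra_simps)
qed

lemma lspan_trans:
  assumes "f \<in> lspan V B" "B \<subseteq> lspan V B'"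
  shows "f \<in> lspan V B'"
  using assms(1)
proof induction
  case (zero f)
  then show ?case by (rule lspan.zero)
next
  case (step f b g c)
  then have "(\<lambda>A. f A + c * b A) \<in> lspan V B'"
    using assms(2) by (intro lspan_add lspan_scale) auto
  then show ?case by (rule lspan_cong) (rule step(3))
qed

lemma lspan_mono: "f \<in> lspan V B \<Longrightarrow> B \<subseteq> B' \<Longrightarrow> f \<in> lspan V B'"
  using lspan_trans lspan_base by (metis subset_iff)

lemma lspan_sum:
  assumes "\<And>i. i \<in> I \<Longrightarrow> f i \<in> lspan V B"
  shows "(\<lambda>A. \<Sum>i\<in>I. f i A) \<in> lspan V B"
  using assms
  by (induction I rule: infinite_finite_induct) (auto intro: lspan.zero lspan_add)

text \<open>Multiplication by \<open>f\<close> is linear, so it suffices to treat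
  generators.\<close>

lemma lspan_mult_left:
  assumes "g \<in> lspan V B" "\<And>b. b \<in> B \<Longrightarrow> (\<lambda>A. f A * b A) \<in> lspan V B'"
  shows "(\<lambda>A. f A * g A) \<in> lspan V B'"
  using assms(1)
proof induction
  case (zero g)
  then show ?case by (intro lspan.zero) simp
next
  case (step g b h c)
  then have "(\<lambda>A. f A * g A + c * (f A * b A)) \<in> lspan V B'"
    using assms(2) by (intro lspan_add lspan_scale) auto
  then show ?case by (rule lspan_cong) (simp add: step(3) algebra_simps)
qed

text \<open>Coefficients are indexed by \<open>R\<close>, not by the image, so \<phi> may take the
  same value at several indices.\<close>

lemma lspan_image_finite:
  assumes "f \<in> lspan V (\<phi> ` R)" "finite R"
  shows "\<exists>c. \<forall>A\<in>V. f A = (\<Sum>r\<in>R. c r * \<phi> r A)"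
  using assms(1)
proof induction
  case (zero f)
  then show ?case by (intro exI[of _ "\<lambda>_. 0"]) simp
next
  case (step f b g d)
  then obtain c r where c: "\<And>A. A \<in> V \<Longrightarrow> f A = (\<Sum>r\<in>R. c r * \<phi> r A)" and r: "r \<in> R" "b = \<phi> r"
    by blast
  have "g A = (\<Sum>s\<in>R. (c s + (if s = r then d else 0)) * \<phi> s A)" if "A \<in> V" for A
  proof -
    have "(\<Sum>s\<in>R. (c s + (if s = r then d else 0)) * \<phi> s A) =
        (\<Sum>s\<in>R. c s * \<phi> s A) + (\<Sum>s\<in>R. if s = r then d * \<phi> s A else 0)"
      unfolding sum.distrib[symmetric] by (rule sum.cong) (auto simp: algebra_simps)
    then show ?thesis
      using step(3)[OF that] c[OF that] r assms(2) by simp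
  qed
  then show ?case by (intro exI[of _ "\<lambda>s. c s + (if s = r then d else 0)"]) blast
qed

section \<open>Monomials filtered by total and diagonal degree\<close>

definition index_pairs :: "nat \<Rightarrow> (nat \<times> nat) set" where
  "index_pairs n = {..<n} \<times> {..<n}"

definition monomial_fun :: "nat \<Rightarrow> (nat \<times> nat \<Rightarrow> nat) \<Rightarrow> complex mat \<Rightarrow> complex" where
  "monomial_fun n e = (\<lambda>A. \<Prod>ij\<in>index_pairs n. A $$ ij ^ e ij)"

definition total_degree :: "nat \<Rightarrow> (nat \<times> nat \<Rightarrow> nat) \<Rightarrow> nat" where
  "total_degree n e = (\<Sum>ij\<in>index_pairs n. e ij)"

definition diag_degree :: "nat \<Rightarrow> (nat \<times> nat \<Rightarrow> nat) \<Rightarrow> nat" where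
  "diag_degree n e = (\<Sum>i<n. e (i, i))"

text \<open>The bound \<open>u\<close> keeps the reduction within a fixed total degree; the bound
  \<open>w\<close> on diagonal factors provides the measure that makes it terminate.\<close>

definition deg_space :: "nat \<Rightarrow> complex mat set \<Rightarrow> nat \<Rightarrow> nat \<Rightarrow> (complex mat \<Rightarrow> complex) set" where
  "deg_space n V u w = lspan V {monomial_fun n e | e. total_degree n e \<le> u \<and> diag_degree n e \<le> w}"

lemma finite_index_pairs [simp]: "finite (index_pairs n)"
  by (simp add: index_pairs_def)

lemma monomial_fun_add: "monomial_fun n (\<lambda>ij. e ij + e' ij) A = monomial_fun n e A * monomial_fun n e' A"
  unfolding monomial_fun_def by (simp add: power_add prod.distrib)

lemma total_degree_add: "total_degree n (\<lambda>ij. e ij + e' ij) = total_degree n e + total_degree n e'"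
  unfolding total_degree_def by (simp add: sum.distrib)

lemma diag_degree_add: "diag_degree n (\<lambda>ij. e ij + e' ij) = diag_degree n e + diag_degree n e'"
  unfolding diag_degree_def by (simp add: sum.distrib)

lemma monomial_fun_single:
  assumes "i < n" "j < n"
  shows "monomial_fun n (\<lambda>ij. if ij = (i, j) then k else 0) A = A $$ (i, j) ^ k"
proof -
  have "monomial_fun n (\<lambda>ij. if ij = (i, j) then k else 0) A =
      (\<Prod>ij\<in>index_pairs n. if ij = (i, j) then A $$ (i, j) ^ k else 1)"
    unfolding monomial_fun_def by (rule prod.cong) auto
  then show ?thesis using assms by (simp add: index_pairs_def)
qed

lemma total_degree_single:
  assumes "i < n" "j < n"
  shows "total_degree n (\<lambda>ij. if ij = (i, j) then k else 0) = k"
  using assms unfolding total_degree_def by (simp add: index_pairs_def)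

lemma diag_degree_single:
  assumes "i < n"
  shows "diag_degree n (\<lambda>ij. if ij = (i, j) then k else 0) = (if i = j then k else 0)"
proof -
  have "diag_degree n (\<lambda>ij. if ij = (i, j) then k else 0) = (\<Sum>a<n. if a = i then (if i = j then k else 0) else 0)"
    unfolding diag_degree_def by (rule sum.cong) auto
  then show ?thesis using assms by simp
qed

lemma deg_space_mono: "f \<in> deg_space n V u w \<Longrightarrow> u \<le> u' \<Longrightarrow> w \<le> w' \<Longrightarrow> f \<in> deg_space n V u' w'"
  unfolding deg_space_def by (erule lspan_mono) auto

lemma deg_space_cong: "f \<in> deg_space n V u w \<Longrightarrow> (\<And>A. A \<in> V \<Longrightarrow> g A = f A) \<Longrightarrow> g \<in> deg_space n V u w"
  unfolding deg_space_def by (rule lspan_cong)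

lemma deg_space_const: "(\<lambda>A. c) \<in> deg_space n V u w"
proof -
  have "monomial_fun n (\<lambda>_. 0) \<in> lspan V {monomial_fun n e | e. total_degree n e \<le> u \<and> diag_degree n e \<le> w}"
    by (rule lspan_base) (force simp: total_degree_def diag_degree_def)
  from lspan_scale[OF this, of c] show ?thesis
    unfolding deg_space_def by (simp add: monomial_fun_def)
qed

lemma deg_space_entry_power:
  assumes "i < n" "j < n"
  shows "(\<lambda>A. A $$ (i, j) ^ k) \<in> deg_space n V k (if i = j then k else 0)"
proof -
  have "monomial_fun n (\<lambda>ij. if ij = (i, j) then k else 0) \<in> deg_space n V k (if i = j then k else 0)"
    unfolding deg_space_def using assms
    by (intro lspan_base CollectI exI[of _ "\<lambda>ij. if ij = (i, j) then k else 0"])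
       (simp add: total_degree_single diag_degree_single)
  then show ?thesis by (rule deg_space_cong) (use assms in \<open>simp add: monomial_fun_single\<close>)
qed

lemma deg_space_add:
  "f \<in> deg_space n V u w \<Longrightarrow> g \<in> deg_space n V u w \<Longrightarrow> (\<lambda>A. f A + g A) \<in> deg_space n V u w"
  unfolding deg_space_def by (rule lspan_add)

lemma deg_space_scale: "f \<in> deg_space n V u w \<Longrightarrow> (\<lambda>A. c * f A) \<in> deg_space n V u w"
  unfolding deg_space_def by (rule lspan_scale)

lemma deg_space_sum:
  "(\<And>i. i \<in> I \<Longrightarrow> f i \<in> deg_space n V u w) \<Longrightarrow> (\<lambda>A. \<Sum>i\<in>I. f i A) \<in> deg_space n V u w"
  unfolding deg_space_def by (rule lspan_sum)

lemma deg_space_mult: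
  assumes "f \<in> deg_space n V u w" "g \<in> deg_space n V u' w'"
  shows "(\<lambda>A. f A * g A) \<in> deg_space n V (u + u') (w + w')"
  unfolding deg_space_def
proof (rule lspan_mult_left[OF assms(2)[unfolded deg_space_def]])
  fix b assume "b \<in> {monomial_fun n e | e. total_degree n e \<le> u' \<and> diag_degree n e \<le> w'}"
  then obtain e' where e': "b = monomial_fun n e'" "total_degree n e' \<le> u'" "diag_degree n e' \<le> w'" by blast
  have "(\<lambda>A. b A * f A) \<in> lspan V {monomial_fun n e | e. total_degree n e \<le> u + u' \<and> diag_degree n e \<le> w + w'}"
  proof (rule lspan_mult_left[OF assms(1)[unfolded deg_space_def]])
    fix d assume "d \<in> {monomial_fun n e | e. total_degree n e \<le> u \<and> diag_degree n e \<le> w}"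
    then obtain e where e: "d = monomial_fun n e" "total_degree n e \<le> u" "diag_degree n e \<le> w" by blast
    show "(\<lambda>A. b A * d A) \<in> lspan V {monomial_fun n e | e. total_degree n e \<le> u + u' \<and> diag_degree n e \<le> w + w'}"
      using e e' by (intro lspan_base CollectI exI[of _ "\<lambda>ij. e' ij + e ij"])
        (auto simp: monomial_fun_add total_degree_add diag_degree_add)
  qed
  then show "(\<lambda>A. f A * b A) \<in> lspan V {monomial_fun n e | e. total_degree n e \<le> u + u' \<and> diag_degree n e \<le> w + w'}"
    by (simp add: mult.commute)
qed

lemma deg_space_prod:
  assumes "\<And>i. i \<in> I \<Longrightarrow> f i \<in> deg_space n V (u i) (w i)"
  shows "(\<lambda>A. \<Prod>i\<in>I. f i A) \<in> deg_space n V (\<Sum>i\<in>I. u i) (\<Sum>i\<in>I. w i)"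
  using assms
  by (induction I rule: infinite_finite_induct) (auto intro: deg_space_const deg_space_mult)

lemma deg_space_power:
  assumes "f \<in> deg_space n V u w"
  shows "(\<lambda>A. f A ^ k) \<in> deg_space n V (k * u) (k * w)"
  using assms by (induction k) (auto intro: deg_space_const deg_space_mult)

lemma polynomial_function_in_deg_space:
  assumes "p \<in> polynomial_functions n"
  shows "\<exists>d. p \<in> deg_space n V d d"
  using assms
proof induction
  case (const c)
  show ?case using deg_space_const by blast
next
  case (entry i j)
  then have "(\<lambda>A. A $$ (i, j)) \<in> deg_space n V 1 1"
    using deg_space_mono[OF deg_space_entry_power[of i n j 1 V], of 1 1] by simp
  then show ?case by blast
next
  case (add p q)
  then obtain d d' where "p \<in> deg_space n V d d" "q \<in> deg_space n V d' d'" by blast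
  then have "(\<lambda>A. p A + q A) \<in> deg_space n V (max d d') (max d d')"
    by (intro deg_space_add) (auto elim: deg_space_mono)
  then show ?case by blast
next
  case (mult p q)
  then show ?case using deg_space_mult by blast
qed

text \<open>Evaluate the characteristic polynomial at the diagonal entry \<open>A $$ (j, j)\<close>: in the Leibniz
  expansion the identity permutation contributes 0, and every other permutation contributes fewer
  than \<open>n\<close> diagonal factors.\<close>

lemma diag_power_reduction:
  assumes "j < length es"
  shows "(\<lambda>A. A $$ (j, j) ^ length es) \<in> deg_space (length es) (spectral_variety es) (length es) (length es - 1)"
proof -
  define n where "n = length es"
  define V where "V = spectral_variety es"
  define cp where "cp = (\<Prod>a\<leftarrow>es. [:- a, 1:])"
  define S where "S = {\<sigma>. \<sigma> permutes {0..<n}} - {id}"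
  define F where "F = (\<lambda>\<sigma> (A :: complex mat). \<Prod>i\<in>{0..<n}. (if i = \<sigma> i then A $$ (j, j) else 0) - A $$ (i, \<sigma> i))"
  have j: "j < n" using assms n_def by simp
  have F_deg: "F \<sigma> \<in> deg_space n V n (n - 1)" if \<sigma>: "\<sigma> \<in> S" for \<sigma>
  proof -
    \<comment> \<open>The fixed points of \<sigma> are the rows whose factor involves diagonal
      entries.\<close>
    define w where "w = (\<lambda>i. if i = \<sigma> i then 1 else 0 :: nat)"
    have perm: "\<sigma> permutes {0..<n}" "\<sigma> \<noteq> id" using \<sigma> unfolding S_def by auto
    have "(\<lambda>A. (if i = \<sigma> i then A $$ (j, j) else 0) - A $$ (i, \<sigma> i)) \<in> deg_space n V 1 (w i)"
      if i: "i \<in> {0..<n}" for i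
    proof -
      have \<sigma>i: "\<sigma> i < n" using i perm(1) permutes_in_image by fastforce
      have "(\<lambda>A. (if i = \<sigma> i then A $$ (j, j) else 0)) \<in> deg_space n V 1 (w i)"
        using deg_space_entry_power[OF j j, of 1 V] deg_space_const[of 0 n V] by (simp add: w_def)
      moreover have "(\<lambda>A. (-1) * A $$ (i, \<sigma> i)) \<in> deg_space n V 1 (w i)"
        using deg_space_entry_power[OF _ \<sigma>i, of i 1 V] i by (intro deg_space_scale) (simp add: w_def)
      ultimately show ?thesis using deg_space_add by fastforce
    qed
    from deg_space_prod[of "{0..<n}", OF this]
    have "F \<sigma> \<in> deg_space n V n (\<Sum>i\<in>{0..<n}. w i)"
      unfolding F_def by simp
    moreover have "(\<Sum>i\<in>{0..<n}. w i) \<le> n - 1"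
    proof -
      \<comment> \<open>A moved point contributes a factor without diagonal entries, which lowers
        the bound by one.\<close>
      obtain i where i: "\<sigma> i \<noteq> i" using perm(2) by (auto simp: fun_eq_iff)
      then have "i \<in> {0..<n}" using permutes_not_in[OF perm(1), of i] by blast
      have "(\<Sum>i\<in>{0..<n}. w i) = (\<Sum>i\<in>{0..<n} - {i}. w i)"
        using i by (intro sum.mono_neutral_right) (auto simp: w_def)
      also have "\<dots> \<le> (\<Sum>i\<in>{0..<n} - {i}. 1)"
        by (rule sum_mono) (simp add: w_def)
      also have "\<dots> = n - 1" using \<open>i \<in> {0..<n}\<close> by simp
      finally show ?thesis .
    qed
    ultimately show ?thesis by (blast intro: deg_space_mono)
  qed
  have eq: "A $$ (j, j) ^ n = (\<Sum>\<sigma>\<in>S. signof \<sigma> * F \<sigma> A) + (\<Sum>i<n. (- coeff cp i) * A $$ (j, j) ^ i)"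
    if A: "A \<in> V" for A
  proof -
    have car: "A \<in> carrier_mat n n" and cpA: "char_poly A = cp"
      using A unfolding V_def spectral_variety_def cp_def n_def by auto
    define c where "c = A $$ (j, j)"
    have "- char_matrix A c = mat n n (\<lambda>(i, l). (if i = l then c else 0) - A $$ (i, l))"
      using car by (intro eq_matI) (auto simp: char_matrix_def)
    then have "poly cp c = det (mat n n (\<lambda>(i, l). (if i = l then c else 0) - A $$ (i, l)))"
      using char_poly_matrix[OF car, of c] cpA by simp
    also have "\<dots> = (\<Sum>\<sigma>\<in>{\<sigma>. \<sigma> permutes {0..<n}}. signof \<sigma> * F \<sigma> A)"
      by (subst det_def'[of _ n]) (auto intro!: sum.cong prod.cong simp: F_def c_def)
    also have "\<dots> = (\<Sum>\<sigma>\<in>S. signof \<sigma> * F \<sigma> A)"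
    proof (rule sum.mono_neutral_right)
      \<comment> \<open>For \<open>i = j\<close> the factor is
        \<open>A $$ (j, j) - A $$ (j, j)\<close>.\<close>
      have "F id A = 0" unfolding F_def using j by (auto intro!: bexI[of _ j])
      then show "\<forall>\<sigma>\<in>{\<sigma>. \<sigma> permutes {0..<n}} - S. signof \<sigma> * F \<sigma> A = 0"
        unfolding S_def by auto
    qed (auto simp: S_def finite_permutations)
    finally have "poly cp c = (\<Sum>\<sigma>\<in>S. signof \<sigma> * F \<sigma> A)" .
    \<comment> \<open>The polynomial is monic of degree \<open>n\<close>, so the top power can be
      solved for.\<close>
    moreover have "poly cp c = (\<Sum>i<n. coeff cp i * c ^ i) + c ^ n"
      using degree_monic_char_poly[OF car] unfolding cpA by (simp add: poly_altdef lessThan_Suc_atMost[symmetric])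
    ultimately show ?thesis unfolding c_def by (simp add: sum_negf algebra_simps)
  qed
  have "(\<lambda>A. (\<Sum>\<sigma>\<in>S. signof \<sigma> * F \<sigma> A) + (\<Sum>i<n. (- coeff cp i) * A $$ (j, j) ^ i)) \<in> deg_space n V n (n - 1)"
  proof (intro deg_space_add deg_space_sum deg_space_scale F_deg)
    fix i assume "i \<in> {..<n}"
    then show "(\<lambda>A. A $$ (j, j) ^ i) \<in> deg_space n V n (n - 1)"
      using deg_space_entry_power[OF j j, of i V] by (auto elim: deg_space_mono)
  qed
  then have "(\<lambda>A. A $$ (j, j) ^ n) \<in> deg_space n V n (n - 1)"
    by (rule deg_space_cong) (rule eq)
  then show ?thesis unfolding n_def V_def .
qed

section \<open>Normal forms of monomials\<close>

definition reduced_exponents :: "nat \<Rightarrow> nat \<Rightarrow> (nat \<times> nat \<Rightarrow> nat) set" where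
  "reduced_exponents n d = (\<Pi>\<^sub>E ij\<in>index_pairs n. if fst ij = snd ij then {..<n} else {..d})"

lemma finite_reduced_exponents: "finite (reduced_exponents n d)"
  unfolding reduced_exponents_def by (intro finite_PiE) auto

text \<open>The \<open>n\<close> diagonal positions have \<open>n\<close> choices each,
  independently of \<open>d\<close>; only the \<open>n^2 - n\<close> others contribute to the growth
  in \<open>d\<close>.\<close>

lemma card_reduced_exponents: "card (reduced_exponents n d) = n ^ n * Suc d ^ (n\<^sup>2 - n)"
proof -
  define D where "D = (\<lambda>i. (i, i)) ` {..<n}"
  have D: "D \<subseteq> index_pairs n" "card D = n"
    unfolding D_def by (auto simp: index_pairs_def card_image inj_on_def)
  have "card (reduced_exponents n d) = (\<Prod>ij\<in>index_pairs n. if fst ij = snd ij then n else Suc d)"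
    unfolding reduced_exponents_def by (subst card_PiE) (auto intro!: prod.cong)
  also have "\<dots> = (\<Prod>ij\<in>index_pairs n - D. if fst ij = snd ij then n else Suc d) *
      (\<Prod>ij\<in>D. if fst ij = snd ij then n else Suc d)"
    by (rule prod.subset_diff) (use D in auto)
  also have "(\<Prod>ij\<in>index_pairs n - D. if fst ij = snd ij then n else Suc d) = (\<Prod>ij\<in>index_pairs n - D. Suc d)"
    by (rule prod.cong) (auto simp: D_def index_pairs_def)
  also have "\<dots> = Suc d ^ (n\<^sup>2 - n)"
    using D finite_subset[OF D(1)] by (simp add: card_Diff_subset index_pairs_def power2_eq_square)
  also have "(\<Prod>ij\<in>D. if fst ij = snd ij then n else Suc d) = n ^ n"
    using D by (simp add: D_def prod.reindex inj_on_def)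
  finally show ?thesis by (simp add: mult.commute)
qed

text \<open>Whenever a diagonal exponent reaches \<open>n\<close>, that \<open>n\<close>-th power is
  replaced by monomials of degree at most \<open>n\<close> with fewer diagonal factors. The diagonal
  degree drops and the total degree does not rise, so the process ends in the box.\<close>

lemma monomial_fun_reduction:
  assumes "total_degree (length es) e \<le> d"
  shows "monomial_fun (length es) e \<in> lspan (spectral_variety es) (monomial_fun (length es) ` reduced_exponents (length es) d)"
  using assms
proof (induction "diag_degree (length es) e" arbitrary: e rule: less_induct)
  case less
  define n where "n = length es"
  define V where "V = spectral_variety es"
  show ?case
  proof (cases "\<forall>i<n. e (i, i) < n")
    case True
    have "e ij \<le> d" if "ij \<in> index_pairs n" for ij
      using member_le_sum[OF that, of e] less.prems unfolding total_degree_def n_def by simp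
    \<comment> \<open>Members of the box are \<open>undefined\<close> outside
      \<open>index_pairs n\<close>; restricting \<open>e\<close> does not change its
      monomial.\<close>
    then have "restrict e (index_pairs n) \<in> reduced_exponents n d"
      unfolding reduced_exponents_def using True by (auto simp: index_pairs_def)
    moreover have "monomial_fun n e = monomial_fun n (restrict e (index_pairs n))"
      unfolding monomial_fun_def by (auto intro!: prod.cong)
    ultimately show ?thesis
      unfolding n_def[symmetric] by (intro lspan_base) auto
  next
    case False
    then obtain j where j: "j < n" "n \<le> e (j, j)" by (auto simp: not_less)
    define e1 where "e1 = (\<lambda>ij. if ij = (j, j) then n else 0 :: nat)"
    define e2 where "e2 = (\<lambda>ij. e ij - e1 ij)"
    have e: "e = (\<lambda>ij. e2 ij + e1 ij)"
      using j unfolding e1_def e2_def by auto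
    have deg: "total_degree n e = total_degree n e2 + n" "diag_degree n e = diag_degree n e2 + n"
      unfolding e total_degree_add diag_degree_add
      using j by (simp_all add: e1_def total_degree_single diag_degree_single)
    have "(\<lambda>A. monomial_fun n e2 A * A $$ (j, j) ^ n) \<in> lspan V (monomial_fun n ` reduced_exponents n d)"
    proof (rule lspan_mult_left)
      show "(\<lambda>A. A $$ (j, j) ^ n) \<in> lspan V {monomial_fun n e | e. total_degree n e \<le> n \<and> diag_degree n e \<le> n - 1}"
        using diag_power_reduction[of j es] j unfolding n_def V_def deg_space_def by simp
      fix b assume "b \<in> {monomial_fun n e | e. total_degree n e \<le> n \<and> diag_degree n e \<le> n - 1}"
      then obtain m where m: "b = monomial_fun n m" "total_degree n m \<le> n" "diag_degree n m \<le> n - 1" by blast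
      have "monomial_fun n (\<lambda>ij. e2 ij + m ij) \<in> lspan V (monomial_fun n ` reduced_exponents n d)"
        unfolding n_def V_def
        by (rule less.hyps) (use m deg j less.prems in
            \<open>auto simp: n_def[symmetric] total_degree_add diag_degree_add\<close>)
      then show "(\<lambda>A. monomial_fun n e2 A * b A) \<in> lspan V (monomial_fun n ` reduced_exponents n d)"
        unfolding m by (rule lspan_cong) (simp add: monomial_fun_add)
    qed
    moreover have "monomial_fun n e A = monomial_fun n e2 A * A $$ (j, j) ^ n" for A
      unfolding e monomial_fun_add e1_def using j by (simp add: monomial_fun_single)
    ultimately show ?thesis
      unfolding n_def[symmetric] V_def[symmetric] by (rule lspan_cong)
  qed
qed

lemma deg_space_reduction:
  assumes "f \<in> deg_space (length es) (spectral_variety es) d w"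
  shows "f \<in> lspan (spectral_variety es) (monomial_fun (length es) ` reduced_exponents (length es) d)"
  using assms unfolding deg_space_def by (rule lspan_trans) (use monomial_fun_reduction in auto)

section \<open>The dimension bound\<close>

text \<open>Gaussian elimination with equations \<open>M\<close> and unknowns \<open>I\<close>: an
  equation with a nonzero coefficient at \<open>i0\<close> removes that equation and that unknown
  together.\<close>

lemma homogeneous_system_nontrivial_solution:
  fixes c :: "'i \<Rightarrow> 'm \<Rightarrow> 'k :: field"
  assumes "finite M" "finite I" "card M < card I"
  shows "\<exists>x. (\<exists>i\<in>I. x i \<noteq> 0) \<and> (\<forall>m\<in>M. (\<Sum>i\<in>I. x i * c i m) = 0)"
  using assms
proof (induction M arbitrary: I c)
  case empty
  then obtain i where "i \<in> I" by fastforce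
  then show ?case by (intro exI[of _ "\<lambda>_. 1"]) auto
next
  case (insert m M)
  show ?case
  proof (cases "\<forall>i\<in>I. c i m = 0")
    case True
    have "card M < card I" using insert.prems insert.hyps by simp
    from insert.IH[OF insert.prems(1) this, of c] show ?thesis using True by auto
  next
    case False
    then obtain i0 where i0: "i0 \<in> I" "c i0 m \<noteq> 0" by blast
    define I' where "I' = I - {i0}"
    define c' where "c' = (\<lambda>i l. c i l - c i m / c i0 m * c i0 l)"
    have "card M < card I'" "finite I'"
      using insert i0 by (auto simp: I'_def)
    then obtain x where x: "\<exists>i\<in>I'. x i \<noteq> 0" "\<And>l. l \<in> M \<Longrightarrow> (\<Sum>i\<in>I'. x i * c' i l) = 0"
      using insert.IH[of I' c'] by blast
    \<comment> \<open>The value at \<open>i0\<close> is what equation \<open>m\<close> dictates once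
      the other unknowns are known.\<close>
    define y where "y = (\<lambda>i. if i = i0 then - (\<Sum>i\<in>I'. x i * c i m) / c i0 m else x i)"
    have "(\<Sum>i\<in>I. y i * c i l) = (\<Sum>i\<in>I'. x i * c' i l)" for l
    proof -
      have "(\<Sum>i\<in>I. y i * c i l) = y i0 * c i0 l + (\<Sum>i\<in>I'. y i * c i l)"
        unfolding I'_def using insert i0 by (intro sum.remove) auto
      also have "(\<Sum>i\<in>I'. y i * c i l) = (\<Sum>i\<in>I'. x i * c i l)"
        by (rule sum.cong) (auto simp: y_def I'_def)
      also have "y i0 * c i0 l = - (\<Sum>i\<in>I'. x i * (c i m / c i0 m * c i0 l))"
        by (simp add: y_def sum_distrib_right sum_divide_distrib mult.assoc)
      finally show ?thesis
        by (simp add: c'_def algebra_simps sum_subtractf)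
    qed
    moreover have "(\<Sum>i\<in>I'. x i * c' i m) = 0"
      using i0 by (simp add: c'_def)
    moreover have "\<exists>i\<in>I. y i \<noteq> 0"
      using x(1) by (auto simp: y_def I'_def)
    ultimately show ?thesis using x(2) by (intro exI[of _ y]) auto
  qed
qed

text \<open>Separates the exponent of the last function from the others, for the induction along the
  chain.\<close>

lemma sum_PiE_lessThan_Suc:
  fixes g :: "(nat \<Rightarrow> nat) \<Rightarrow> complex"
  shows "(\<Sum>a\<in>{..<Suc k} \<rightarrow>\<^sub>E {..s}. g a) = (\<Sum>x\<le>s. \<Sum>b\<in>{..<k} \<rightarrow>\<^sub>E {..s}. g (b(k := x)))"
proof -
  have "inj_on (\<lambda>(x, b). b(k := x)) ({..s} \<times> ({..<k} \<rightarrow>\<^sub>E {..s}))"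
    using inj_combinator[of k "{..<k}" "\<lambda>_. {..s}"] by simp
  moreover have "({..<Suc k} \<rightarrow>\<^sub>E {..s}) = (\<lambda>(x, b). b(k := x)) ` ({..s} \<times> ({..<k} \<rightarrow>\<^sub>E {..s}))"
    using PiE_insert_eq[of k "{..<k}" "\<lambda>_. {..s}"] by (simp add: lessThan_Suc)
  ultimately show ?thesis
    by (simp add: sum.reindex sum.cartesian_product case_prod_unfold)
qed

text \<open>Sort a relation by powers of \<open>F k\<close> and look at the lowest one: on the irreducible \<open>C (Suc k)\<close>
  that power can be cancelled, and on \<open>C k\<close>, where \<open>F k\<close> vanishes, only its coefficient remains.\<close>

lemma chain_monomials_independent:
  assumes "\<And>i. i \<le> k \<Longrightarrow> prime_set n (C i)" "\<And>i. i < k \<Longrightarrow> C i \<subseteq> C (Suc i)"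
    and "\<And>i. i < k \<Longrightarrow> F i \<in> polynomial_functions n"
    and "\<And>i A. i < k \<Longrightarrow> A \<in> C i \<Longrightarrow> F i A = 0"
    and "\<And>i. i < k \<Longrightarrow> \<exists>A\<in>C (Suc i). F i A \<noteq> 0"
    and "\<And>A. A \<in> C k \<Longrightarrow> (\<Sum>a\<in>{..<k} \<rightarrow>\<^sub>E {..s}. c a * (\<Prod>i<k. F i A ^ a i)) = 0"
    and "a \<in> {..<k} \<rightarrow>\<^sub>E {..s}"
  shows "c a = 0"
  using assms
proof (induction k arbitrary: c a)
  case 0
  have "C 0 \<noteq> {}" using "0.prems"(1)[of 0] unfolding prime_set_def by simp
  then show ?case using "0.prems"(6,7) by auto
next
  case (Suc k)
  \<comment> \<open>\<open>g x\<close> is the coefficient of \<open>F k ^ x\<close> in the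
    relation.\<close>
  define g where "g = (\<lambda>x A. \<Sum>b\<in>{..<k} \<rightarrow>\<^sub>E {..s}. c (b(k := x)) * (\<Prod>i<k. F i A ^ b i))"
  have g_poly: "g x \<in> polynomial_functions n" for x
    unfolding g_def using Suc.prems(3)
    by (intro polynomial_functions_sum polynomial_functions.mult polynomial_functions.const
        polynomial_functions_prod polynomial_functions_power) auto
  have split: "(\<Sum>x\<le>s. F k A ^ x * g x A) = 0" if "A \<in> C (Suc k)" for A
  proof -
    have "c (b(k := x)) * (\<Prod>i<Suc k. F i A ^ (b(k := x)) i) =
        F k A ^ x * (c (b(k := x)) * (\<Prod>i<k. F i A ^ b i))" for b x
    proof -
      have "(\<Prod>i<k. F i A ^ (b(k := x)) i) = (\<Prod>i<k. F i A ^ b i)"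
        by (rule prod.cong) auto
      then show ?thesis by simp
    qed
    then show ?thesis
      using Suc.prems(6)[OF that] by (simp only: sum_PiE_lessThan_Suc g_def sum_distrib_left)
  qed
  have zero: "\<forall>b\<in>{..<k} \<rightarrow>\<^sub>E {..s}. c (b(k := x)) = 0" if "x \<le> s" for x
    using that
  proof (induction x rule: less_induct)
    case (less x)
    have low: "g y A = 0" if "y < x" for y A
    proof -
      have "y \<le> s" using less.prems that by simp
      from less.IH[OF that this] show ?thesis
        unfolding g_def by (intro sum.neutral) (simp del: fun_upd_apply)
    qed
    define H where "H = (\<lambda>A. \<Sum>y\<in>{x..s}. F k A ^ (y - x) * g y A)"
    have "F k A ^ x * H A = 0" if A: "A \<in> C (Suc k)" for A
    proof -
      have "F k A ^ x * H A = (\<Sum>y\<in>{x..s}. F k A ^ y * g y A)"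
        unfolding H_def sum_distrib_left
        by (rule sum.cong) (auto simp flip: power_add mult.assoc)
      also have "\<dots> = (\<Sum>y\<le>s. F k A ^ y * g y A)"
        by (rule sum.mono_neutral_left) (use low in \<open>auto simp: not_le\<close>)
      finally show ?thesis using split[OF A] by simp
    qed
    moreover have "(\<lambda>A. F k A ^ x) \<in> polynomial_functions n" "H \<in> polynomial_functions n"
      unfolding H_def using Suc.prems(3)[of k]
      by (intro polynomial_functions_sum polynomial_functions.mult polynomial_functions_power g_poly; simp)+
    ultimately have "(\<forall>A\<in>C (Suc k). F k A ^ x = 0) \<or> (\<forall>A\<in>C (Suc k). H A = 0)"
      by (intro prime_setD[OF Suc.prems(1)[OF order.refl]]) auto
    then have H0: "H A = 0" if "A \<in> C k" for A
      using that Suc.prems(5)[of k] Suc.prems(2)[of k] by auto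
    have "g x A = 0" if A: "A \<in> C k" for A
    proof -
      \<comment> \<open>At \<open>y = x\<close> the exponent of \<open>F k\<close> is 0, so this
        term survives although \<open>F k A = 0\<close>.\<close>
      have "H A = (\<Sum>y\<in>{x}. F k A ^ (y - x) * g y A)"
        unfolding H_def
        by (rule sum.mono_neutral_right) (use less.prems Suc.prems(4)[OF _ A] in auto)
      then show ?thesis using H0[OF A] by simp
    qed
    then show ?case
      using Suc.prems unfolding g_def by (intro ballI Suc.IH[where c = "\<lambda>b. c (b(k := x))"]) auto
  qed
  have "a k \<le> s" using Suc.prems(7) by (auto simp: PiE_def Pi_def)
  \<comment> \<open>Extensional functions on \<open>{..<k}\<close> take the value
    \<open>undefined\<close> at \<open>k\<close>, so the last exponent is overwritten and then put
    back.\<close>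
  moreover have "a(k := undefined) \<in> {..<k} \<rightarrow>\<^sub>E {..s}"
    using Suc.prems(7) by (auto simp: PiE_def Pi_def extensional_def)
  ultimately have "c ((a(k := undefined))(k := a k)) = 0" using zero by blast
  then show ?case by simp
qed

text \<open>Choose \<open>F i\<close> vanishing on \<open>C i\<close> but not on
  \<open>C (Suc i)\<close>. The \<open>Suc s ^ k\<close> products of their powers with exponents at
  most \<open>s\<close> are independent on the top member of the chain, while on the variety they
  lie in the span of the reduced monomials for degree \<open>d * s\<close>.\<close>

lemma chain_length_growth_bound:
  assumes chain: "irreducible_chain (length es) k (spectral_variety es)"
  shows "\<exists>d. \<forall>s. Suc s ^ k \<le> card (reduced_exponents (length es) (d * s))"
proof -
  define n where "n = length es"
  define V where "V = spectral_variety es"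
  obtain C where C: "\<And>i. i \<le> k \<Longrightarrow> absolutely_irreducible_variety n (C i)" "\<And>i. i \<le> k \<Longrightarrow> C i \<subseteq> V"
    "\<And>i. i < k \<Longrightarrow> C i \<subset> C (Suc i)"
    using chain unfolding irreducible_chain_def n_def V_def by blast
  have "\<exists>p\<in>polynomial_functions n. (\<forall>A\<in>C i. p A = 0) \<and> (\<exists>A\<in>C (Suc i). p A \<noteq> 0)" if "i < k" for i
  proof -
    have alg: "algebraic_set n (C i)" "algebraic_set n (C (Suc i))"
      using C(1)[of i] C(1)[of "Suc i"] that unfolding absolutely_irreducible_variety_def by auto
    then have cl: "zclosure n (C i) = C i" "C (Suc i) \<subseteq> carrier_mat n n"
      by (auto simp: zclosure_algebraic_set) (auto simp: algebraic_set_def)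
    from C(3)[OF that] cl obtain A where "A \<in> C (Suc i)" "A \<notin> zclosure n (C i)" "A \<in> carrier_mat n n"
      by blast
    then show ?thesis unfolding zclosure_def by blast
  qed
  then obtain F where F: "\<And>i. i < k \<Longrightarrow> F i \<in> polynomial_functions n"
    "\<And>i A. i < k \<Longrightarrow> A \<in> C i \<Longrightarrow> F i A = 0" "\<And>i. i < k \<Longrightarrow> \<exists>A\<in>C (Suc i). F i A \<noteq> 0"
    by metis
  have "\<forall>i. \<exists>d. i < k \<longrightarrow> F i \<in> deg_space n V d d"
    using F(1) polynomial_function_in_deg_space by blast
  then obtain dd where dd: "\<And>i. i < k \<Longrightarrow> F i \<in> deg_space n V (dd i) (dd i)" by metis
  \<comment> \<open>The degree bound of the product of all \<open>F i\<close>; with exponents at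
    most \<open>s\<close> the degree is at most \<open>d * s\<close>.\<close>
  define d where "d = (\<Sum>i<k. dd i)"
  have "Suc s ^ k \<le> card (reduced_exponents n (d * s))" for s
  proof (rule ccontr)
    define E where "E = {..<k} \<rightarrow>\<^sub>E {..s}"
    define R where "R = reduced_exponents n (d * s)"
    assume "\<not> ?thesis"
    moreover have "card E = Suc s ^ k" "finite E"
      unfolding E_def by (auto simp: card_PiE intro!: finite_PiE)
    ultimately have "card R < card E" "finite E" "finite R"
      unfolding R_def by (auto simp: finite_reduced_exponents)
    have "\<exists>c. \<forall>A\<in>V. (\<Prod>i<k. F i A ^ a i) = (\<Sum>r\<in>R. c r * monomial_fun n r A)" if a: "a \<in> E" for a
    proof -
      have "(\<lambda>A. \<Prod>i<k. F i A ^ a i) \<in> deg_space n V (\<Sum>i<k. a i * dd i) (\<Sum>i<k. a i * dd i)"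
        using dd by (intro deg_space_prod deg_space_power) auto
      moreover have "(\<Sum>i<k. a i * dd i) \<le> d * s"
      proof -
        have "(\<Sum>i<k. a i * dd i) \<le> (\<Sum>i<k. s * dd i)"
          using a unfolding E_def by (intro sum_mono mult_le_mono1) (auto simp: PiE_def Pi_def)
        then show ?thesis by (simp add: d_def sum_distrib_left mult.commute)
      qed
      ultimately have "(\<lambda>A. \<Prod>i<k. F i A ^ a i) \<in> deg_space n V (d * s) (d * s)"
        by (blast intro: deg_space_mono)
      then have "(\<lambda>A. \<Prod>i<k. F i A ^ a i) \<in> lspan V (monomial_fun n ` R)"
        using deg_space_reduction unfolding n_def V_def R_def by blast
      then show ?thesis
        using lspan_image_finite \<open>finite R\<close> by fastforce
    qed
    then obtain c where c: "\<And>a A. a \<in> E \<Longrightarrow> A \<in> V \<Longrightarrow>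
        (\<Prod>i<k. F i A ^ a i) = (\<Sum>r\<in>R. c a r * monomial_fun n r A)"
      by metis
    obtain x where x: "\<exists>a\<in>E. x a \<noteq> 0" "\<And>r. r \<in> R \<Longrightarrow> (\<Sum>a\<in>E. x a * c a r) = 0"
      using homogeneous_system_nontrivial_solution[OF \<open>finite R\<close> \<open>finite E\<close> \<open>card R < card E\<close>, of c] by blast
    have "(\<Sum>a\<in>E. x a * (\<Prod>i<k. F i A ^ a i)) = 0" if A: "A \<in> C k" for A
    proof -
      have "(\<Sum>a\<in>E. x a * (\<Prod>i<k. F i A ^ a i)) = (\<Sum>a\<in>E. \<Sum>r\<in>R. x a * c a r * monomial_fun n r A)"
        using c A C(2)[of k] by (intro sum.cong) (auto simp: sum_distrib_left mult.assoc)
      also have "\<dots> = (\<Sum>r\<in>R. (\<Sum>a\<in>E. x a * c a r) * monomial_fun n r A)"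
        by (subst sum.swap) (simp add: sum_distrib_right)
      finally show ?thesis using x(2) by simp
    qed
    note relation = this
    have "x a = 0" if "a \<in> E" for a
    proof (rule chain_monomials_independent[where k = k and n = n and C = C and F = F and s = s and c = x and a = a])
      show "prime_set n (C i)" if "i \<le> k" for i
        using C(1)[OF that] by (rule irreducible_imp_prime_set)
      show "C i \<subseteq> C (Suc i)" if "i < k" for i
        using C(3)[OF that] by blast
      show "(\<Sum>a\<in>{..<k} \<rightarrow>\<^sub>E {..s}. x a * (\<Prod>i<k. F i A ^ a i)) = 0" if "A \<in> C k" for A
        using relation[OF that] unfolding E_def .
      show "a \<in> {..<k} \<rightarrow>\<^sub>E {..s}" using that unfolding E_def .
    qed (fact F)+
    then show False using x(1) by blast
  qed
  then show ?thesis unfolding n_def by blast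
qed

text \<open>Compares growth in \<open>s\<close>: the left side of the bound has order
  \<open>k\<close>, the right side order \<open>N\<close>.\<close>

lemma irreducible_chain_spectral_variety_le:
  assumes "irreducible_chain (length es) k (spectral_variety es)"
  shows "k \<le> (length es)\<^sup>2 - length es"
proof (rule ccontr)
  define n where "n = length es"
  define N where "N = n\<^sup>2 - n"
  assume "\<not> ?thesis"
  then have k: "Suc N \<le> k" unfolding N_def n_def by simp
  obtain d where d: "\<And>s. Suc s ^ k \<le> n ^ n * Suc (d * s) ^ N"
    using chain_length_growth_bound[OF assms] unfolding card_reduced_exponents n_def N_def by blast
  \<comment> \<open>The constant left after \<open>Suc (d * s) \<le> Suc d * Suc s\<close>;
    cancelling \<open>Suc s ^ N\<close> would leave \<open>Suc s \<le> s\<close>.\<close>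
  define s where "s = n ^ n * Suc d ^ N"
  have "Suc s ^ N * Suc s = Suc s ^ Suc N" by simp
  also have "\<dots> \<le> Suc s ^ k" using k by (rule power_increasing) simp
  also have "\<dots> \<le> n ^ n * Suc (d * s) ^ N" by (rule d)
  also have "\<dots> \<le> n ^ n * (Suc d * Suc s) ^ N"
    by (intro mult_le_mono2 power_mono) auto
  also have "\<dots> = Suc s ^ N * s" unfolding s_def by (simp only: power_mult_distrib mult_ac)
  finally show False by simp
qed

lemma variety_dim_spectral_variety:
  assumes "es \<noteq> []"
  shows "variety_dim (length es) (spectral_variety es) = enat ((length es)\<^sup>2 - length es)"
proof -
  have "variety_dim (length es) (spectral_variety es) =
      Sup (enat ` {k. irreducible_chain (length es) k (spectral_variety es)})"
    unfolding variety_dim_def irreducible_chain_def by (rule arg_cong[of _ _ Sup]) auto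
  also have "\<dots> = enat ((length es)\<^sup>2 - length es)"
    by (rule Sup_eqI)
       (use irreducible_chain_spectral_variety[OF assms] irreducible_chain_spectral_variety_le in auto)
  finally show ?thesis .
qed

section \<open>Splitting \<open>f\<close> over the complex numbers and conclusion\<close>

lemma char_poly_variety_eq_spectral_variety:
  assumes "lead_coeff f = 1"
  obtains es where "length es = degree f" "char_poly_variety (degree f) f = spectral_variety es"
proof -
  define F :: "complex poly" where "F = map_poly of_int f"
  have deg: "degree F = degree f" unfolding F_def by (simp add: degree_map_poly)
  then have "lead_coeff F = 1" using assms unfolding F_def by (simp add: coeff_map_poly)
  moreover obtain es where es: "Polynomial.smult (lead_coeff F) (\<Prod>a\<leftarrow>es. [:- a, 1:]) = F" "length es = degree F"
    using fundamental_theorem_algebra_factorized[of F] by blast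
  ultimately have "F = (\<Prod>a\<leftarrow>es. [:- a, 1:])" by simp
  then have "char_poly_variety (degree f) f = spectral_variety es"
    unfolding char_poly_variety_def spectral_variety_def es(2) deg F_def[symmetric] by simp
  then show ?thesis using that es(2) deg by simp
qed

theorem lemma4p5:
  fixes n :: nat and f :: "int poly"
  assumes "n \<ge> 2"
    and "lead_coeff f = 1"
    and "degree f = n"
  shows "absolutely_irreducible_variety n (char_poly_variety n f)
    \<and> \<not> affine_linear_subspace n (char_poly_variety n f)
    \<and> variety_dim n (char_poly_variety n f) = enat (n\<^sup>2 - n)"
proof -
  obtain es where es: "length es = degree f" "char_poly_variety (degree f) f = spectral_variety es"
    using char_poly_variety_eq_spectral_variety[OF assms(2)] .
  then have "length es = n" "es \<noteq> []" using assms by auto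
  then show ?thesis
    using irreducible_spectral_variety[of es] spectral_variety_not_affine[of es]
      variety_dim_spectral_variety[of es] es assms by simp
qed

end
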